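(* Let $X,Y$ be Banach spaces and let $A\in\mathcal{C}(X,Y)$ be a lower semi-Fredholm operator. Then: 1. There exists $\varepsilon>0$ (depending only on $A$) such that for every infinite $\mathbb{N}'\subset\mathbb{N}$ and every sequence $(A_n)_{n\in\mathbb{N}'}\subset\mathcal{C}(X,Y)$ with nonzero domains satisfying $\mathcal{FSS}\lambda_{\mathbb{N}'}[A_n,A]<\varepsilon$, the operators $A_n$ are lower semi-Fredholm for all large enough $n\in\mathbb{N}'$, and $\varlimsup_{n\in\mathbb{N}'}\dim \mathrm{Ker}(A_n)<\infty$. 2. There exists $\varepsilon>0$ (depending only on $A$) such that for every infinite $\mathbb{N}'\subset\mathbb{N}$ and every sequence $(A_n)_{n\in\mathbb{N}'}\subset\mathcal{C}(X,Y)$ with nonzero domains satisfying $\mathcal{SS}\lambda_{\mathbb{N}'}[A_n,A]<\varepsilon$, the operators $A_n$ are lower semi-Fredholm for all large enough $n\in\mathbb{N}'$.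
   Context: Conventions: $\mathbb{N}'$ is an infinite subset of $\mathbb{N}$, $\mathbb{N}''$ an infinite subset of $\mathbb{N}'$, $\mathbb{N}'''$ an infinite subset of $\mathbb{N}''$, etc.; limits are taken along these index sets. $\theta$ is the null element. Dimensions are finite numbers or $\infty$. $\mathcal{C}(X,Y)$ is the set of closed linear operators from (a linear subspace $dom(A)$ of) $X$ to $Y$, i.e. those whose graph $G_A=\{(x,Ax)\mid x\in dom(A)\}$ is closed in $X\times Y$; the domain may be a proper subspace. $X\times Y$ carries the norm $\max\{\|x\|,\|y\|\}$. $A\in\mathcal{C}(X,Y)$ is lower semi-Fredholm if its image $R(A)$ is closed in $Y$ and $\dim \mathrm{Ker}(A)<\infty$. Uniform $\lambda$-adjustment. Let $(M_n)_{\mathbb{N}'}$, $(P_n)_{\mathbb{N}'}$ be sequences of closed subspaces of a Banach space $E$ with $M_n\neq\{\theta\}$ for all $n$, and let $\lambda\ge 0$. $(M_n)_{\mathbb{N}'}$ is lower uniformly $\lambda$-adjusted with $(P_n)_{\mathbb{N}'}$ if for every $\eta>0$, every infinite $\mathbb{N}''\subset\mathbb{N}'$ and all unit vectors $x_n\in M_n$ ($n\in\mathbb{N}''$), there exist an infinite $\mathbb{N}'''\subset\mathbb{N}''$, vectors $y_n\in P_n$ ($n\in\mathbb{N}'''$) and a vector $z\in E$ such that $\varlimsup_{n\in\mathbb{N}'''}\|x_n-y_n-z\|\le\lambda+\eta$. $\lambda_{\mathbb{N}'}[M_n,P_n]$ is the infimum of all such $\lambda$. Strictly singular uniform $\lambda$-adjustment.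 For the same data, $\mathcal{SS}\lambda_{\mathbb{N}'}[M_n,P_n]$ is the infimum of all $\lambda\ge0$ such that: for every infinite $\mathbb{N}''\subset\mathbb{N}'$ and all closed subspaces $K_n\subset M_n$ with $\dim K_n=\infty$ ($n\in\mathbb{N}''$), there exist an infinite $\mathbb{N}'''\subset\mathbb{N}''$ and closed subspaces $L_n\subset K_n$ with $\dim L_n=\infty$ ($n\in\mathbb{N}'''$) such that $\lambda_{\mathbb{N}'''}[L_n,P_n]\le\lambda$. Finitely strictly singular uniform $\lambda$-adjustment. $\mathcal{FSS}\lambda_{\mathbb{N}'}[M_n,P_n]$ is the infimum of all $\lambda\ge0$ such that: for every infinite $\mathbb{N}''\subset\mathbb{N}'$ and all subspaces $K_n\subset M_n$ with $\dim K_n<\infty$ ($n\in\mathbb{N}''$) and $\lim_{n\in\mathbb{N}''}\dim K_n=\infty$, there exist an infinite $\mathbb{N}'''\subset\mathbb{N}''$ and nonzero subspaces $L_n\subset K_n$ ($n\in\mathbb{N}'''$) with $\lim_{n\in\mathbb{N}'''}\dim L_n=\infty$ and $\lambda_{\mathbb{N}'''}[L_n,P_n]\le\lambda$. For sequences of operators $(A_n)_{\mathbb{N}'},(B_n)_{\mathbb{N}'}\subset\mathcal{C}(X,Y)$ these numbers are defined through graphs in $X\times Y$: $\mathcal{SS}\lambda_{\mathbb{N}'}[A_n,B_n]:=\mathcal{SS}\lambda_{\mathbb{N}'}[G_{A_n},G_{B_n}]$ and $\mathcal{FSS}\lambda_{\mathbb{N}'}[A_n,B_n]:=\mathcal{FSS}\lambda_{\mathbb{N}'}[G_{A_n},G_{B_n}]$;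 if $B_n=B$ for all $n$ one writes $B$ in place of $B_n$. *)

theory Defs
  imports "HOL-Analysis.Analysis"
begin

text \<open>
  Scalars range over a type of sort \<open>{real_normed_field, euclidean_space}\<close>. The reals and the
  complex numbers are instances, and up to isomorphism there are no others, so real and complex
  Banach spaces are treated at once. The type class \<open>banach\<close> supplies the complete norm;
  the scalar multiplication \<open>s\<close> extends the real one that comes with that class.
\<close>

definition banach_space_over :: "('k::{real_normed_field,euclidean_space} \<Rightarrow> 'e::banach \<Rightarrow> 'e) \<Rightarrow> bool"
  where "banach_space_over s \<longleftrightarrow>
    vector_space s \<and>
    (\<forall>c x. norm (s c x) = norm c * norm x) \<and>
    (\<forall>r x. s (of_real r) x = r *\<^sub>R x)"

lemma banach_space_over_real: "banach_space_over ((*\<^sub>R) :: real \<Rightarrow> 'e::banach \<Rightarrow> 'e)"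
  unfolding banach_space_over_def by (simp add: real_vector.vector_space_axioms)

lemma banach_space_over_complex: "banach_space_over ((*) :: complex \<Rightarrow> complex \<Rightarrow> complex)"
  unfolding banach_space_over_def
  by (auto simp: vector_space_def algebra_simps norm_mult scaleR_conv_of_real)

text \<open>
  The library's \<open>dim\<close> is \<open>0\<close> on infinite-dimensional subspaces, hence an
  extended dimension.
\<close>

definition edim :: "('k::field \<Rightarrow> 'e::ab_group_add \<Rightarrow> 'e) \<Rightarrow> 'e set \<Rightarrow> enat"
  where "edim s V =
    (if \<exists>B. finite B \<and> V \<subseteq> module.span s B then enat (vector_space.dim s V) else \<infinity>)"

definition closed_subspace :: "('k::field \<Rightarrow> 'e::{ab_group_add,topological_space} \<Rightarrow> 'e) \<Rightarrow> 'e set \<Rightarrow> bool"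
  where "closed_subspace s V \<longleftrightarrow> module.subspace s V \<and> closed V"

text \<open>The filter of limits along an infinite index set \<open>N\<close>.\<close>

definition along :: "nat set \<Rightarrow> nat filter"
  where "along N = inf sequentially (principal N)"

text \<open>
  The norm \<open>\<nu>\<close> is a parameter because the class norm of a product type is the Euclidean
  combination of the two norms, while the maximum norm is wanted. The two are equivalent, so
  closedness refers to the class topology throughout.

  Sequences indexed by an infinite set \<open>N\<close> are functions on \<open>nat\<close> of which only the
  values on \<open>N\<close> matter. When the members of \<open>P\<close> are subspaces, \<open>\<kappa> = 1\<close> belongs
  to each of the three sets below, so the real infima are taken over nonempty sets that are bounded
  below.
\<close>

definition lower_uniformly_adjusted ::
    "('e::ab_group_add \<Rightarrow> real) \<Rightarrow> nat set \<Rightarrow> (nat \<Rightarrow> 'e set) \<Rightarrow> (nat \<Rightarrow> 'e set) \<Rightarrow> real \<Rightarrow> bool"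
  where "lower_uniformly_adjusted \<nu> N M P \<kappa> \<longleftrightarrow>
    (\<forall>\<eta>>0. \<forall>N' x. N' \<subseteq> N \<and> infinite N' \<and> (\<forall>n\<in>N'. x n \<in> M n \<and> \<nu> (x n) = 1) \<longrightarrow>
      (\<exists>N'' y z. N'' \<subseteq> N' \<and> infinite N'' \<and> (\<forall>n\<in>N''. y n \<in> P n) \<and>
        Limsup (along N'') (\<lambda>n. ereal (\<nu> (x n - y n - z))) \<le> ereal (\<kappa> + \<eta>)))"

definition uadj ::
    "('e::ab_group_add \<Rightarrow> real) \<Rightarrow> nat set \<Rightarrow> (nat \<Rightarrow> 'e set) \<Rightarrow> (nat \<Rightarrow> 'e set) \<Rightarrow> real"
  where "uadj \<nu> N M P = Inf {\<kappa>. \<kappa> \<ge> 0 \<and> lower_uniformly_adjusted \<nu> N M P \<kappa>}"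

definition SS_adjusted ::
    "('k::field \<Rightarrow> 'e::{ab_group_add,topological_space} \<Rightarrow> 'e) \<Rightarrow> ('e \<Rightarrow> real) \<Rightarrow>
      nat set \<Rightarrow> (nat \<Rightarrow> 'e set) \<Rightarrow> (nat \<Rightarrow> 'e set) \<Rightarrow> real \<Rightarrow> bool"
  where "SS_adjusted s \<nu> N M P \<kappa> \<longleftrightarrow>
    (\<forall>N' K. N' \<subseteq> N \<and> infinite N' \<and>
        (\<forall>n\<in>N'. closed_subspace s (K n) \<and> K n \<subseteq> M n \<and> edim s (K n) = \<infinity>) \<longrightarrow>
      (\<exists>N'' L. N'' \<subseteq> N' \<and> infinite N'' \<and>
        (\<forall>n\<in>N''. closed_subspace s (L n) \<and> L n \<subseteq> K n \<and> edim s (L n) = \<infinity>) \<and>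
        uadj \<nu> N'' L P \<le> \<kappa>))"

definition SS_uadj ::
    "('k::field \<Rightarrow> 'e::{ab_group_add,topological_space} \<Rightarrow> 'e) \<Rightarrow> ('e \<Rightarrow> real) \<Rightarrow>
      nat set \<Rightarrow> (nat \<Rightarrow> 'e set) \<Rightarrow> (nat \<Rightarrow> 'e set) \<Rightarrow> real"
  where "SS_uadj s \<nu> N M P = Inf {\<kappa>. \<kappa> \<ge> 0 \<and> SS_adjusted s \<nu> N M P \<kappa>}"

definition FSS_adjusted ::
    "('k::field \<Rightarrow> 'e::ab_group_add \<Rightarrow> 'e) \<Rightarrow> ('e \<Rightarrow> real) \<Rightarrow>
      nat set \<Rightarrow> (nat \<Rightarrow> 'e set) \<Rightarrow> (nat \<Rightarrow> 'e set) \<Rightarrow> real \<Rightarrow> bool"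
  where "FSS_adjusted s \<nu> N M P \<kappa> \<longleftrightarrow>
    (\<forall>N' K. N' \<subseteq> N \<and> infinite N' \<and>
        (\<forall>n\<in>N'. module.subspace s (K n) \<and> K n \<subseteq> M n \<and> edim s (K n) < \<infinity>) \<and>
        ((\<lambda>n. edim s (K n)) \<longlongrightarrow> \<infinity>) (along N') \<longrightarrow>
      (\<exists>N'' L. N'' \<subseteq> N' \<and> infinite N'' \<and>
        (\<forall>n\<in>N''. module.subspace s (L n) \<and> L n \<subseteq> K n \<and> L n \<noteq> {0}) \<and>
        ((\<lambda>n. edim s (L n)) \<longlongrightarrow> \<infinity>) (along N'') \<and>
        uadj \<nu> N'' L P \<le> \<kappa>))"

definition FSS_uadj ::
    "('k::field \<Rightarrow> 'e::ab_group_add \<Rightarrow> 'e) \<Rightarrow> ('e \<Rightarrow> real) \<Rightarrow>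
      nat set \<Rightarrow> (nat \<Rightarrow> 'e set) \<Rightarrow> (nat \<Rightarrow> 'e set) \<Rightarrow> real"
  where "FSS_uadj s \<nu> N M P = Inf {\<kappa>. \<kappa> \<ge> 0 \<and> FSS_adjusted s \<nu> N M P \<kappa>}"

text \<open>
  A partially defined operator is a domain together with a total function whose values outside the
  domain are irrelevant.
\<close>

datatype ('a, 'b) partial_op = Partial_Op (op_dom: "'a set") (op_app: "'a \<Rightarrow> 'b")

definition op_graph :: "('a, 'b) partial_op \<Rightarrow> ('a \<times> 'b) set"
  where "op_graph A = {(x, op_app A x) | x. x \<in> op_dom A}"

definition op_range :: "('a, 'b) partial_op \<Rightarrow> 'b set"
  where "op_range A = op_app A ` op_dom A"

definition op_ker :: "('a, 'b::zero) partial_op \<Rightarrow> 'a set"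
  where "op_ker A = {x \<in> op_dom A. op_app A x = 0}"

definition closed_operator ::
    "('k::{real_normed_field,euclidean_space} \<Rightarrow> 'a::banach \<Rightarrow> 'a) \<Rightarrow> ('k \<Rightarrow> 'b::banach \<Rightarrow> 'b) \<Rightarrow>
      ('a, 'b) partial_op \<Rightarrow> bool"
  where "closed_operator sX sY A \<longleftrightarrow>
    module.subspace sX (op_dom A) \<and>
    (\<forall>x\<in>op_dom A. \<forall>y\<in>op_dom A. op_app A (x + y) = op_app A x + op_app A y) \<and>
    (\<forall>c. \<forall>x\<in>op_dom A. op_app A (sX c x) = sY c (op_app A x)) \<and>
    closed (op_graph A)"

definition lower_semi_Fredholm ::
    "('k::{real_normed_field,euclidean_space} \<Rightarrow> 'a::banach \<Rightarrow> 'a) \<Rightarrow> ('k \<Rightarrow> 'b::banach \<Rightarrow> 'b) \<Rightarrow>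
      ('a, 'b) partial_op \<Rightarrow> bool"
  where "lower_semi_Fredholm sX sY A \<longleftrightarrow>
    closed_operator sX sY A \<and> closed (op_range A) \<and> edim sX (op_ker A) < \<infinity>"

definition max_norm :: "'a::real_normed_vector \<times> 'b::real_normed_vector \<Rightarrow> real"
  where "max_norm p = max (norm (fst p)) (norm (snd p))"

definition SS_uadj_op ::
    "('k::{real_normed_field,euclidean_space} \<Rightarrow> 'a::banach \<Rightarrow> 'a) \<Rightarrow> ('k \<Rightarrow> 'b::banach \<Rightarrow> 'b) \<Rightarrow>
      nat set \<Rightarrow> (nat \<Rightarrow> ('a, 'b) partial_op) \<Rightarrow> (nat \<Rightarrow> ('a, 'b) partial_op) \<Rightarrow> real"
  where "SS_uadj_op sX sY N A B =
    SS_uadj (module_prod.scale sX sY) max_norm N (\<lambda>n. op_graph (A n)) (\<lambda>n. op_graph (B n))"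

definition FSS_uadj_op ::
    "('k::{real_normed_field,euclidean_space} \<Rightarrow> 'a::banach \<Rightarrow> 'a) \<Rightarrow> ('k \<Rightarrow> 'b::banach \<Rightarrow> 'b) \<Rightarrow>
      nat set \<Rightarrow> (nat \<Rightarrow> ('a, 'b) partial_op) \<Rightarrow> (nat \<Rightarrow> ('a, 'b) partial_op) \<Rightarrow> real"
  where "FSS_uadj_op sX sY N A B =
    FSS_uadj (module_prod.scale sX sY) max_norm N (\<lambda>n. op_graph (A n)) (\<lambda>n. op_graph (B n))"

end

theory Submission
  imports Defs "HOL-Library.Ramsey"
begin

text \<open>
  If a closed operator \<open>T\<close> is not lower semi-Fredholm, then for every \<open>\<delta> > 0\<close> some
  infinite-dimensional subspace of its domain satisfies \<open>norm (T v) \<le> \<delta> * norm v\<close>. Indeed there are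
  bounded separated vectors \<open>u n\<close> with \<open>T (u n) \<longlonglongrightarrow> 0\<close>, and a finite-dimensional \<open>F\<close> on which
  \<open>T\<close> is small can be enlarged by a difference \<open>u i - u j\<close> that is almost orthogonal to
  \<open>F\<close>. Such a difference comes from Ramsey's theorem, without Hahn-Banach: if all differences
  were bad for one vector \<open>g\<close>, averaging \<open>g + (v l - v (l + 1))\<close> over a long chain would give a
  vector close to \<open>g\<close> of norm well below that of \<open>g\<close>.

  Conversely, let the graph subspaces \<open>L n\<close> lie in the cone \<open>norm y \<le> \<epsilon> * norm x\<close> with dimensions
  tending to infinity. By Riesz' lemma they contain unit vectors whose first components are
  \<open>1/4\<close>-separated. Adjustment to the graph of a lower semi-Fredholm \<open>A\<close>, together with the open
  mapping theorem and the compactness of bounded sets in the kernel of \<open>A\<close>, makes two of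
  these vectors closer than \<open>1/4\<close> once \<open>\<epsilon>\<close> is small.
\<close>

section \<open>Finite-dimensional subspaces\<close>

context vector_space
begin

lemma edim_le_card:
  assumes "finite B" "V \<subseteq> span B"
  shows "edim scale V \<le> enat (card B)"
  using assms dim_le_card unfolding edim_def by auto

lemma card_le_edim:
  assumes "finite B" "independent B" "B \<subseteq> V"
  shows "enat (card B) \<le> edim scale V"
proof (cases "\<exists>C. finite C \<and> V \<subseteq> span C")
  case True
  then obtain C where C: "finite C" "V \<subseteq> span C" by blast
  obtain D where D: "D \<subseteq> V" "independent D" "V \<subseteq> span D" "card D = dim V"
    using basis_exists by blast
  have "finite D" using independent_span_bound[OF C(1) D(2)] C D by blast
  then have "card B \<le> card D" using independent_span_bound[of D B] D assms by blast
  then show ?thesis using True D(4) by (simp add: edim_def)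
next
  case False
  then have "edim scale V = \<infinity>" unfolding edim_def by (rule if_not_P)
  then show ?thesis by simp
qed

lemma edim_span_independent:
  assumes "finite B" "independent B"
  shows "edim scale (span B) = enat (card B)"
  using edim_le_card[of B "span B"] card_le_edim[of B "span B"] assms
  by (auto intro: antisym simp: span_superset)

lemma independent_subset_of_edim:
  assumes "enat m \<le> edim scale V"
  obtains B where "finite B" "independent B" "B \<subseteq> V" "card B = m"
proof -
  obtain D where D: "D \<subseteq> V" "independent D" "V \<subseteq> span D"
    using maximal_independent_subset by blast
  have "\<exists>B\<subseteq>D. finite B \<and> card B = m"
  proof (cases "finite D")
    case True
    then have "m \<le> card D" using edim_le_card[OF True D(3)] assms
      by (metis enat_ord_simps(1) order_trans)
    then show ?thesis by (metis obtain_subset_with_card_n)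
  qed (metis infinite_arbitrarily_large)
  then show thesis using D that independent_mono by (metis subset_trans)
qed

lemma finite_dim_basis:
  assumes "subspace V" "edim scale V < \<infinity>"
  obtains B where "finite B" "B \<subseteq> V" "V = span B" "edim scale V = enat (card B)"
proof -
  from assms obtain C where C: "finite C" "V \<subseteq> span C" by (auto simp: edim_def split: if_splits)
  obtain D where D: "D \<subseteq> V" "independent D" "V \<subseteq> span D"
    using maximal_independent_subset by blast
  have fD: "finite D" using independent_span_bound[OF C(1) D(2)] C D by blast
  moreover have "V = span D" using D assms by (simp add: span_minimal subset_antisym)
  ultimately show thesis using that D edim_span_independent by metis
qed

end

text \<open>The image of a finite spanning set spans the image. Linearity is asked only on
  \<open>V\<close>, so that the bound applies to partial operators and to the inverse of a
  projection restricted to a subspace.\<close>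

lemma edim_image_le:
  assumes s1: "vector_space s1" and s2: "vector_space s2"
    and V: "module.subspace s1 V"
    and add: "\<And>x y. x \<in> V \<Longrightarrow> y \<in> V \<Longrightarrow> f (x + y) = f x + f y"
    and scale: "\<And>c x. x \<in> V \<Longrightarrow> f (s1 c x) = s2 c (f x)"
  shows "edim s2 (f ` V) \<le> edim s1 V"
proof (cases "edim s1 V < \<infinity>")
  case True
  interpret a: vector_space s1 by fact
  interpret b: vector_space s2 by fact
  obtain B where B: "finite B" "B \<subseteq> V" "V = a.span B" "edim s1 V = enat (card B)"
    using a.finite_dim_basis[OF V True] by blast
  have V0: "0 \<in> V" using a.subspace_0[OF V] .
  have "f 0 = 0" using scale[OF V0, of 0] by simp
  have "a.subspace {x \<in> V. f x \<in> b.span (f ` B)}"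
    by (rule a.subspaceI)
      (auto simp: V0 \<open>f 0 = 0\<close> add scale a.subspace_add[OF V] a.subspace_scale[OF V]
        b.span_zero intro: b.span_add b.span_scale)
  moreover have "B \<subseteq> {x \<in> V. f x \<in> b.span (f ` B)}"
    using B(2) by (auto intro: b.span_base)
  ultimately have "a.span B \<subseteq> {x \<in> V. f x \<in> b.span (f ` B)}" by (rule a.span_minimal[rotated])
  then have "f ` V \<subseteq> b.span (f ` B)" using B(3) by auto
  then have "edim s2 (f ` V) \<le> enat (card (f ` B))" using B(1) by (intro b.edim_le_card) auto
  also have "\<dots> \<le> edim s1 V" using B(1) by (simp add: B(4) card_image_le)
  finally show ?thesis .
qed simp

lemma infdist_lessD:
  assumes "A \<noteq> {}" "infdist x A < r"
  obtains a where "a \<in> A" "dist x a < r"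
proof -
  have "bdd_below (dist x ` A)" by (rule bdd_belowI[of _ 0]) auto
  then show thesis using assms that by (auto simp: infdist_notempty cINF_less_iff)
qed

section \<open>Banach spaces over the scalar field: compact balls and Riesz' lemma\<close>

locale banach_over =
  fixes s :: "'k::{real_normed_field,euclidean_space} \<Rightarrow> 'e::banach \<Rightarrow> 'e"
  assumes banach: "banach_space_over s"
begin

sublocale vector_space s
  using banach unfolding banach_space_over_def by blast

lemma norm_s [simp]: "norm (s c x) = norm c * norm x"
  using banach unfolding banach_space_over_def by blast

lemma s_of_real: "s (of_real r) x = r *\<^sub>R x"
  using banach unfolding banach_space_over_def by blast

lemma subspace_scaleR: "subspace V \<Longrightarrow> x \<in> V \<Longrightarrow> r *\<^sub>R x \<in> V"
  using subspace_scale[of V x "of_real r"] by (simp add: s_of_real)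

lemma bounded_linear_s_left: "bounded_linear (\<lambda>a. s a b)"
proof (rule bounded_linear_intro)
  show "s (r *\<^sub>R x) b = r *\<^sub>R s x b" for r x
    by (metis s_of_real scale_scale scaleR_conv_of_real)
qed (auto simp: scale_left_distrib)

lemma bounded_linear_s_right: "bounded_linear (s c)"
proof (rule bounded_linear_intro)
  show "s c (r *\<^sub>R x) = r *\<^sub>R s c x" for r x
    by (metis s_of_real scale_left_commute)
  show "norm (s c x) \<le> norm x * norm c" for x by (simp add: mult.commute)
qed (simp add: scale_right_distrib)

lemma subspace_closure:
  assumes "subspace V"
  shows "subspace (closure V)"
proof (rule subspaceI)
  show "0 \<in> closure V" using subspace_0[OF assms] closure_subset by blast
  fix x y assume "x \<in> closure V" "y \<in> closure V"
  then obtain f g where fg: "\<And>n. f n \<in> V" "f \<longlonglongrightarrow> x" "\<And>n. g n \<in> V" "g \<longlonglongrightarrow> y"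
    unfolding closure_sequential by blast
  then show "x + y \<in> closure V" unfolding closure_sequential
    by (intro exI[of _ "\<lambda>n. f n + g n"]) (auto intro: subspace_add[OF assms] tendsto_add)
next
  fix c x assume "x \<in> closure V"
  then obtain f where fg: "\<And>n. f n \<in> V" "f \<longlonglongrightarrow> x"
    unfolding closure_sequential by blast
  then show "s c x \<in> closure V" unfolding closure_sequential
    by (intro exI[of _ "\<lambda>n. s c (f n)"])
      (auto intro: subspace_scale[OF assms] bounded_linear.tendsto[OF bounded_linear_s_right])
qed

text \<open>A convergent sequence is bounded, so it stays in one of the compact pieces, and its
  limit does too.\<close>

lemma closed_if_compact_balls:
  fixes V :: "'e set"
  assumes "\<And>r. compact (V \<inter> cball 0 r)"
  shows "closed V"
  unfolding closed_sequential_limits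
proof safe
  fix x l assume x: "\<forall>n. x n \<in> V" "x \<longlonglongrightarrow> l"
  then have "bounded (range x)" by (simp add: convergent_imp_bounded)
  then obtain r where "\<And>n. norm (x n) \<le> r" by (auto simp: bounded_iff)
  then have "\<forall>n. x n \<in> V \<inter> cball 0 r" using x by auto
  then show "l \<in> V"
    using compact_imp_closed[OF assms] x(2) closed_sequential_limits by (metis IntD1)
qed

text \<open>Induction on \<open>B\<close>. A new vector \<open>b\<close> outside the closed
  \<open>span B\<close> has positive distance from it, which bounds its coefficient; the ball in the
  larger span is then a closed part of a continuous image of a compact set. Balls in the scalar
  field are compact because it is a Euclidean space.\<close>

lemma compact_span_cball:
  assumes "finite B"
  shows "compact (span B \<inter> cball 0 r)"
  using assms
proof (induction B arbitrary: r rule: finite_induct)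
  case empty
  show ?case by (simp add: Int_insert_left)
next
  case (insert b B)
  show ?case
  proof (cases "b \<in> span B")
    case True
    then show ?thesis using insert.IH by (simp add: span_redundant)
  next
    case False
    have cl: "closed (span B)" using insert.IH by (rule closed_if_compact_balls)
    define d where "d = infdist b (span B)"
    have ne: "span B \<noteq> {}" using span_zero by blast
    have d: "d > 0" using infdist_pos_not_in_closed[OF cl ne False] by (simp add: d_def)
    define h where "h = (\<lambda>(a, f). s a b + f)"
    \<comment> \<open>The radii come from writing \<open>x = s a b + f\<close> with
      \<open>norm x \<le> r\<close>: the distance \<open>d\<close> forces
      \<open>norm a \<le> r / d\<close>, and the triangle inequality then bounds
      \<open>f\<close>.\<close>
    define K where "K = cball (0::'k) (r / d) \<times> (span B \<inter> cball 0 (r + r / d * norm b))"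
    have "compact K" unfolding K_def using insert.IH by (intro compact_Times) auto
    moreover have "continuous_on K h" unfolding h_def case_prod_beta
      by (intro continuous_intros bounded_linear.continuous_on[OF bounded_linear_s_left])
    ultimately have "compact (h ` K)" by (rule compact_continuous_image[rotated])
    moreover have "span (insert b B) \<inter> cball 0 r = h ` K \<inter> cball 0 r"
    proof safe
      fix x assume x: "x \<in> span (insert b B)" "x \<in> cball 0 r"
      then obtain a where a: "x - s a b \<in> span B" by (auto simp: span_insert)
      have n: "norm x \<le> r" using x(2) by simp
      have ad: "norm a * d \<le> norm x"
      proof (cases "a = 0")
        case False
        \<comment> \<open>Dividing by \<open>a\<close> exhibits a point of \<open>span B\<close> at
          distance \<open>norm x / norm a\<close> from \<open>b\<close>, so this quotient is at
          least \<open>d\<close>.\<close>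
        have "s (inverse a) (x - s a b) \<in> span B" using a by (rule span_scale)
        then have "- (s (inverse a) (x - s a b)) \<in> span B" by (rule span_neg)
        then have "d \<le> dist b (- (s (inverse a) (x - s a b)))" unfolding d_def by (rule infdist_le)
        also have "b - (- (s (inverse a) (x - s a b))) = s (inverse a) x"
          using False by (simp add: scale_right_diff_distrib)
        then have "dist b (- (s (inverse a) (x - s a b))) = norm x / norm a"
          by (simp add: dist_norm norm_inverse divide_inverse mult.commute)
        finally show ?thesis using False by (simp add: field_simps)
      qed simp
      have na: "norm a \<le> r / d" using ad n d by (simp add: pos_le_divide_eq)
      have "norm (x - s a b) \<le> norm x + norm (s a b)" by (rule norm_triangle_ineq4)
      also have "\<dots> \<le> r + r / d * norm b"
        using n mult_right_mono[OF na norm_ge_zero[of b]] by simp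
      finally have "(a, x - s a b) \<in> K" using na a by (simp add: K_def)
      then show "x \<in> h ` K" by (rule rev_image_eqI) (simp add: h_def)
    next
      fix a f assume "(a, f) \<in> K"
      then have "f \<in> span B" by (simp add: K_def)
      then show "h (a, f) \<in> span (insert b B)" by (auto simp: h_def span_insert intro!: exI[of _ a])
    qed
    ultimately show ?thesis by (simp add: compact_Int_closed)
  qed
qed

text \<open>A vector \<open>v\<close> outside the span is approximated by some \<open>w\<close> in
  it up to less than twice the distance. Normalising \<open>v - w\<close> then loses at most a
  factor of two, whence the \<open>1/2\<close>.\<close>

lemma Riesz_unit_vector:
  assumes "subspace V" "finite B" "B \<subseteq> V" "\<not> V \<subseteq> span B"
  obtains x where "x \<in> V" "norm x = 1" "\<And>y. y \<in> span B \<Longrightarrow> 1/2 \<le> dist x y"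
proof -
  obtain v where v: "v \<in> V" "v \<notin> span B" using assms by blast
  have cl: "closed (span B)"
    using compact_span_cball[OF assms(2)] by (rule closed_if_compact_balls)
  have ne: "span B \<noteq> {}" using span_zero by blast
  define d where "d = infdist v (span B)"
  have d: "d > 0" using infdist_pos_not_in_closed[OF cl ne v(2)] by (simp add: d_def)
  obtain w where w: "w \<in> span B" "dist v w < 2 * d"
    using infdist_lessD[OF ne, of v "2 * d"] d by (auto simp: d_def)
  define t where "t = norm (v - w)"
  have t: "t > 0" "t < 2 * d" using w v by (auto simp: t_def dist_norm)
  define x where "x = (1 / t) *\<^sub>R (v - w)"
  have spB: "span B \<subseteq> V" using assms by (simp add: span_minimal)
  show thesis
  proof
    show "x \<in> V" unfolding x_def
      by (intro subspace_scaleR subspace_diff assms v) (use w spB in auto)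
    show "norm x = 1" using t by (simp add: x_def t_def[symmetric])
    fix y assume y: "y \<in> span B"
    have "w + t *\<^sub>R y \<in> span B" using w y by (intro span_add subspace_scaleR) auto
    then have "d \<le> dist v (w + t *\<^sub>R y)" unfolding d_def by (rule infdist_le)
    also have "v - (w + t *\<^sub>R y) = t *\<^sub>R (x - y)" using t by (simp add: x_def algebra_simps)
    then have "dist v (w + t *\<^sub>R y) = t * dist x y" using t by (simp add: dist_norm)
    finally have "d \<le> t * dist x y" .
    moreover have "t * dist x y \<le> 2 * d * dist x y" using t by (intro mult_right_mono) auto
    ultimately have "d * 1 \<le> d * (2 * dist x y)" by simp
    then show "1/2 \<le> dist x y" using d by (simp add: mult_le_cancel_left)
  qed
qed

text \<open>
  The points of \<open>K\<close> need not lie in \<open>V\<close>: those within \<open>1/4\<close> of \<open>V\<close> are moved into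
  \<open>V\<close> before Riesz' lemma is applied, which costs half of the distance \<open>1/2\<close>.
\<close>

lemma unit_vector_away_from_finite:
  assumes "subspace V" "finite K" "enat (Suc (card K)) \<le> edim s V"
  obtains x where "x \<in> V" "norm x = 1" "\<And>y. y \<in> K \<Longrightarrow> 1/4 \<le> dist x y"
proof -
  define K1 where "K1 = {y \<in> K. \<exists>v\<in>V. dist v y < 1/4}"
  have "\<forall>y\<in>K1. \<exists>v. v \<in> V \<and> dist v y < 1/4" by (auto simp: K1_def)
  from bchoice[OF this] obtain g where g: "\<And>y. y \<in> K1 \<Longrightarrow> g y \<in> V \<and> dist (g y) y < 1/4"
    by blast
  have K1: "K1 \<subseteq> K" by (auto simp: K1_def)
  have fin: "finite (g ` K1)" using K1 assms(2) finite_subset by blast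
  have sub: "g ` K1 \<subseteq> V" using g by blast
  have "card (g ` K1) \<le> card K"
    by (meson K1 assms(2) card_image_le card_mono finite_subset order_trans)
  then have "\<not> V \<subseteq> span (g ` K1)"
    using edim_le_card[OF fin] assms(3)
    by (metis Suc_n_not_le_n enat_ord_simps(1) order_trans)
  then obtain x where x: "x \<in> V" "norm x = 1" "\<And>y. y \<in> span (g ` K1) \<Longrightarrow> 1/2 \<le> dist x y"
    using Riesz_unit_vector[OF assms(1) fin sub] by blast
  have "1/4 \<le> dist x y" if "y \<in> K" for y
  proof (rule ccontr)
    assume "\<not> 1/4 \<le> dist x y"
    then have "dist x y < 1/4" by simp
    then have y: "y \<in> K1" unfolding K1_def using x(1) that by blast
    have "1/2 \<le> dist x (g y)" using y by (intro x(3) span_base) auto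
    then show False using \<open>\<not> 1/4 \<le> dist x y\<close> g[OF y] dist_triangle[of x "g y" y]
      by (simp add: dist_commute)
  qed
  then show thesis using that x by blast
qed

end

section \<open>Small subspaces of a seminorm\<close>

text \<open>A greedy choice that picks index and point together. The predicate depends on the index
  so that the points can be drawn from different members of a sequence of sets.\<close>

lemma separated_sequence:
  fixes Q :: "nat \<Rightarrow> 'a::metric_space \<Rightarrow> bool"
  assumes ex: "\<And>K N. finite K \<Longrightarrow> \<exists>n>N. \<exists>x. Q n x \<and> (\<forall>y\<in>K. e \<le> dist x y)"
  obtains r :: "nat \<Rightarrow> nat" and x where "strict_mono r" "\<And>i. Q (r i) (x i)" "\<And>i j. i < j \<Longrightarrow> e \<le> dist (x j) (x i)"
proof -
  define P where "P = (\<lambda>(f :: nat \<Rightarrow> nat \<times> 'a) k p. Q (fst p) (snd p) \<and>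
    (\<forall>j<k. fst (f j) < fst p \<and> e \<le> dist (snd p) (snd (f j))))"
  have "\<exists>f. \<forall>k::nat. P f k (f k)"
  proof (rule dependent_wellorder_choice)
    fix f :: "nat \<Rightarrow> nat \<times> 'a" and k :: nat
    \<comment> \<open>An index above the sum of all earlier indices exceeds each of them.\<close>
    obtain n x where n: "(\<Sum>j<k. fst (f j)) < n" and x: "Q n x" "\<forall>y\<in>snd ` f ` {..<k}. e \<le> dist x y"
      using ex[of "snd ` f ` {..<k}" "\<Sum>j<k. fst (f j)"] by blast
    have "fst (f j) < n" if "j < k" for j
      using n that member_le_sum[of j "{..<k}" "\<lambda>j. fst (f j)"] by simp
    then have "P f k (n, x)" using x by (auto simp: P_def)
    then show "\<exists>p. P f k p" by blast
  qed (auto simp: P_def)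
  then obtain f where f: "\<And>k. P f k (f k)" by blast
  show thesis
  proof (rule that[of "fst \<circ> f" "snd \<circ> f"])
    show "strict_mono (fst \<circ> f)" using f by (auto simp: P_def strict_mono_def)
    show "Q ((fst \<circ> f) i) ((snd \<circ> f) i)" for i using f[of i] by (simp add: P_def)
    show "e \<le> dist ((snd \<circ> f) j) ((snd \<circ> f) i)" if "i < j" for i j
      using f[of j] that by (simp add: P_def)
  qed
qed

text \<open>Without convergent subsequences the closure of the range is complete but not compact,
  hence not totally bounded; a radius \<open>e\<close> admitting no finite cover makes a greedy
  choice with separation \<open>e/2\<close> possible.\<close>

lemma separated_subsequence:
  fixes v :: "nat \<Rightarrow> 'a::complete_space"
  assumes no_lim: "\<And>r l. strict_mono r \<Longrightarrow> \<not> (v \<circ> r) \<longlonglongrightarrow> l"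
  obtains e and r :: "nat \<Rightarrow> nat" where "e > 0" "strict_mono r" "\<And>i j. i < j \<Longrightarrow> e \<le> dist (v (r j)) (v (r i))"
proof -
  have "\<not> compact (closure (range v))"
  proof
    assume "compact (closure (range v))"
    then have "seq_compact (closure (range v))" by (rule compact_imp_seq_compact)
    moreover have "\<And>n. v n \<in> closure (range v)" by (meson closure_subset rangeI subsetD)
    ultimately obtain l r where "strict_mono r" "(v \<circ> r) \<longlonglongrightarrow> l"
      using seq_compactE[of "closure (range v)" v] by blast
    then show False using no_lim by blast
  qed
  moreover have "complete (closure (range v))" by (simp add: complete_eq_closed)
  ultimately obtain e where e: "e > 0"
    and nc: "\<And>k. finite k \<Longrightarrow> \<not> closure (range v) \<subseteq> (\<Union>x\<in>k. ball x e)"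
    unfolding compact_eq_totally_bounded by blast
  have "\<exists>n>N. \<exists>x. x = v n \<and> (\<forall>y\<in>K. e/2 \<le> dist x y)" if "finite K" for K N
  proof (rule ccontr)
    assume no: "\<not> ?thesis"
    \<comment> \<open>The first terms are added as centres so that a failure beyond \<open>N\<close>
      would yield a cover of the whole range. Closed balls of half the radius also cover the
      closure.\<close>
    let ?K = "K \<union> v ` {..N}"
    have "range v \<subseteq> (\<Union>x\<in>?K. cball x (e/2))"
    proof safe
      fix n show "v n \<in> (\<Union>x\<in>?K. cball x (e/2))"
      proof (cases "n \<le> N")
        case True
        then show ?thesis using e by (intro UN_I[of "v n"]) auto
      next
        case False
        then obtain y where "y \<in> K" "dist (v n) y < e/2" using no by (auto simp: not_le)
        then show ?thesis by (intro UN_I[of y]) (auto simp: dist_commute)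
      qed
    qed
    moreover have "closed (\<Union>x\<in>?K. cball x (e/2))" using that by (intro closed_UN) auto
    ultimately have "closure (range v) \<subseteq> (\<Union>x\<in>?K. cball x (e/2))" by (rule closure_minimal)
    also have "\<dots> \<subseteq> (\<Union>x\<in>?K. ball x e)"
      using e by (intro UN_mono order_refl) auto
    finally show False using nc[of ?K] that by simp
  qed
  then obtain r :: "nat \<Rightarrow> nat" and x where rx: "strict_mono r" "\<And>i. x i = v (r i)"
      "\<And>i j. i < j \<Longrightarrow> e/2 \<le> dist (x j) (x i)"
    using separated_sequence[of "\<lambda>n x. x = v n" "e/2"] by blast
  show thesis
  proof (rule that[of "e/2" r])
    show "e/2 \<le> dist (v (r j)) (v (r i))" if "i < j" for i j using rx(3)[OF that] by (simp add: rx(2))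
  qed (use e rx(1) in auto)
qed

text \<open>The estimate is uniform over \<open>C\<close> because a finite net of \<open>C\<close>
  supplies the colours for Ramsey's theorem: a failing pair of indices is coloured by a net point
  that it shortens.\<close>

lemma almost_orthogonal_difference:
  fixes u :: "nat \<Rightarrow> 'a::real_normed_vector"
  assumes C: "compact C" and u: "\<And>n. norm (u n) \<le> c" and \<eta>: "\<eta> > 0"
  shows "\<exists>i j. N \<le> i \<and> i < j \<and> (\<forall>f\<in>C. norm f - \<eta> \<le> norm (f + (u i - u j)))"
proof (rule ccontr)
  assume "\<not> ?thesis"
  then have H: "\<exists>f\<in>C. norm (f + (u i - u j)) < norm f - \<eta>" if "N \<le> i" "i < j" for i j
    using that by (meson not_le)
  have "\<eta>/3 > 0" using \<eta> by simp
  then obtain K where K: "finite K" "C \<subseteq> (\<Union>x\<in>K. ball x (\<eta>/3))"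
    using C unfolding compact_eq_totally_bounded by blast
  obtain k and m :: nat where k: "K = k ` {..<m}"
    using finite_imp_nat_seg_image_inj_on[OF K(1)] by (metis lessThan_def)
  \<comment> \<open>Of the loss \<open>\<eta>\<close> at a point of \<open>C\<close>, passing to a
    net point within \<open>\<eta>/3\<close> costs \<open>\<eta>/3\<close> in each of the two norms,
    and \<open>\<eta>/3\<close> remains.\<close>
  define bad where
    "bad = (\<lambda>g i j. norm (g + (u i - u j)) < norm g - \<eta>/3)"
  have bad_ex: "\<exists>t<m. bad (k t) i j" if ij: "N \<le> i" "i < j" for i j
  proof -
    obtain f where f: "f \<in> C" "norm (f + (u i - u j)) < norm f - \<eta>" using H[OF ij] by blast
    then obtain t where t: "t < m" "dist (k t) f < \<eta>/3" using K k by auto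
    have "norm (k t + (u i - u j)) \<le> norm (f + (u i - u j)) + norm (k t - f)"
      using norm_triangle_ineq[of "f + (u i - u j)" "k t - f"] by (simp add: algebra_simps)
    moreover have "norm f \<le> norm (k t) + norm (k t - f)"
      by (metis norm_minus_commute norm_triangle_sub)
    ultimately have "bad (k t) i j" using f t by (simp add: bad_def dist_norm)
    then show ?thesis using t by blast
  qed
  \<comment> \<open>Ramsey's theorem colours unordered pairs; \<open>Min\<close> and
    \<open>Max\<close> recover the order.\<close>
  define col where "col = (\<lambda>S. SOME t. t < m \<and> bad (k t) (Min S) (Max S))"
  have col: "col {i, j} < m \<and> bad (k (col {i, j})) i j" if "N \<le> i" "i < j" for i j
    using someI_ex[OF bad_ex[OF that]] that by (simp add: col_def)
  have "\<forall>x\<in>{N..}. \<forall>y\<in>{N..}. x \<noteq> y \<longrightarrow> col {x, y} < m"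
    using col by (metis atLeast_iff insert_commute nat_neq_iff)
  then obtain Y t where Y: "Y \<subseteq> {N..}" "infinite Y" "\<forall>x\<in>Y. \<forall>y\<in>Y. x \<noteq> y \<longrightarrow> col {x, y} = t"
    using Ramsey2[OF infinite_Ici, of N col m] by blast
  define g where "g = k t"
  define v where "v = (\<lambda>l. u (enumerate Y l))"
  have shift: "norm (g + (v l - v (Suc l))) \<le> norm g - \<eta>/3" for l
  proof -
    have in_Y: "enumerate Y l \<in> Y" "enumerate Y (Suc l) \<in> Y" using Y by (auto intro: enumerate_in_set)
    have less: "enumerate Y l < enumerate Y (Suc l)" using Y by (intro enumerate_step)
    have "col {enumerate Y l, enumerate Y (Suc l)} = t" using Y(3) in_Y less by (metis less_irrefl)
    then show ?thesis
      using col[of "enumerate Y l" "enumerate Y (Suc l)"] in_Y Y(1) less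
      by (auto simp: bad_def g_def v_def)
  qed
  \<comment> \<open>The sum of \<open>M\<close> shortened vectors telescopes to
    \<open>real M *\<^sub>R g\<close> up to an error of norm at most \<open>2 * c\<close>, while
    each summand falls short of \<open>norm g\<close> by \<open>\<eta>/3\<close>.\<close>
  have bound: "real M * (\<eta>/3) \<le> 2 * c" for M
  proof -
    have eq: "(\<Sum>l<M. g + (v l - v (Suc l))) = real M *\<^sub>R g + (v 0 - v M)"
      by (simp only: sum.distrib sum_lessThan_telescope' sum_constant_scaleR card_lessThan)
    have "norm (\<Sum>l<M. g + (v l - v (Suc l))) \<le> (\<Sum>l<M. norm g - \<eta>/3)"
      using shift by (intro sum_norm_le)
    then have "norm (real M *\<^sub>R g + (v 0 - v M)) \<le> real M * norm g - real M * (\<eta>/3)"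
      unfolding eq by (simp add: right_diff_distrib)
    moreover have "norm (real M *\<^sub>R g) \<le> norm (real M *\<^sub>R g + (v 0 - v M)) + norm (v 0 - v M)"
      by (metis add_diff_cancel norm_triangle_ineq4)
    moreover have "norm (v 0 - v M) \<le> c + c"
      unfolding v_def by (intro norm_triangle_le_diff add_mono u)
    ultimately show ?thesis by simp
  qed
  obtain M :: nat where "2 * c / (\<eta>/3) < real M" using reals_Archimedean2 by blast
  then have "2 * c < real M * (\<eta>/3)" using \<eta> by (simp add: field_simps)
  then show False using bound[of M] by simp
qed

text \<open>The seminorm laws are required on \<open>D\<close> alone, since \<open>q\<close> will be
  the norm of a partial operator, which is linear only on its domain.\<close>

locale subspace_seminorm = banach_over s
  for s :: "'k::{real_normed_field,euclidean_space} \<Rightarrow> 'e::banach \<Rightarrow> 'e" +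
  fixes D :: "'e set" and q :: "'e \<Rightarrow> real"
  assumes D: "subspace D"
    and q_add: "\<And>x y. x \<in> D \<Longrightarrow> y \<in> D \<Longrightarrow> q (x + y) \<le> q x + q y"
    and q_scale: "\<And>c x. x \<in> D \<Longrightarrow> q (s c x) = norm c * q x"
begin

lemma q_zero: "q 0 = 0"
  using q_scale[OF subspace_0[OF D], of 0] by simp

lemma q_diff:
  assumes "x \<in> D" "y \<in> D"
  shows "q (x - y) \<le> q x + q y"
  using q_add[of x "s (- 1) y"] q_scale[of y "- 1"] assms subspace_scale[OF D, of y "- 1"]
  by simp

text \<open>The new vector is a late difference \<open>u i - u j\<close>: \<open>q\<close> is tiny
  on it, its norm is at least \<open>e\<close>, and it is almost orthogonal to a large ball of
  \<open>span B\<close>. The gap between \<open>a\<close> and \<open>b\<close> absorbs the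
  errors.\<close>

lemma extend_small_span:
  assumes B: "finite B" "B \<subseteq> D" and small: "\<And>f. f \<in> span B \<Longrightarrow> q f \<le> a * norm f"
    and ab: "0 \<le> a" "a < b"
    and u: "\<And>n. u n \<in> D" "\<And>n. norm (u n) \<le> c"
    and e: "0 < e" "\<And>i j. i < j \<Longrightarrow> e \<le> dist (u j) (u i)"
    and lim: "(\<lambda>n. q (u n)) \<longlonglongrightarrow> 0"
  obtains x where "x \<in> D" "x \<notin> span B" "\<And>y. y \<in> span (insert x B) \<Longrightarrow> q y \<le> b * norm y"
proof -
  have spB: "span B \<subseteq> D" using B D by (simp add: span_minimal)
  have c: "c \<ge> 0" using u(2)[of 0] norm_ge_zero order_trans by blast
  \<comment> \<open>Beyond \<open>R\<close> the gap \<open>(b - a) * norm f\<close> outweighs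
    everything that \<open>x\<close> contributes. The bounds on \<open>\<eta>\<close> and
    \<open>\<tau>\<close> keep \<open>a * \<eta> + \<tau>\<close> at most
    \<open>(b - a) * e / 8\<close>, half of the gain \<open>(b - a) * (e/4)\<close> available inside
    the ball.\<close>
  define R where "R = (1 + 2 * c * b) / (b - a) + 2 * c"
  define \<eta> where "\<eta> = min (e/2) ((b - a) * e / (16 * (a + 1)))"
  define \<tau> where "\<tau> = min 1 ((b - a) * e / 16)"
  have "(b - a) * e / (16 * (a + 1)) > 0" using ab e(1) by (intro divide_pos_pos mult_pos_pos) auto
  then have \<eta>: "\<eta> > 0" unfolding \<eta>_def using e(1) by simp
  have \<eta>_le: "\<eta> \<le> e/2" unfolding \<eta>_def by (rule min.cobounded1)
  have "\<eta> \<le> (b - a) * e / (16 * (a + 1))" unfolding \<eta>_def by (rule min.cobounded2)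
  then have "\<eta> * (16 * (a + 1)) \<le> (b - a) * e" using ab by (subst (asm) pos_le_divide_eq) auto
  moreover have "\<eta> * (16 * (a + 1)) = 16 * (a * \<eta>) + 16 * \<eta>" by (simp add: algebra_simps)
  ultimately have a\<eta>: "a * \<eta> \<le> (b - a) * e / 16" using \<eta> by linarith
  have \<tau>: "\<tau> > 0" "\<tau> \<le> 1" "\<tau> \<le> (b - a) * e / 16" using e ab by (auto simp: \<tau>_def)
  have "\<tau>/2 > 0" using \<tau> by simp
  then obtain N where N: "\<And>n. n \<ge> N \<Longrightarrow> q (u n) < \<tau>/2"
    using order_tendstoD(2)[OF lim] unfolding eventually_sequentially by blast
  have "\<exists>i j. N \<le> i \<and> i < j \<and>
      (\<forall>f\<in>span B \<inter> cball 0 R. norm f - \<eta> \<le> norm (f + (u i - u j)))"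
    by (intro almost_orthogonal_difference[where c = c] compact_span_cball B(1) u(2) \<eta>)
  then obtain i j where ij: "N \<le> i" "i < j"
    and orth: "\<And>f. f \<in> span B \<inter> cball 0 R \<Longrightarrow> norm f - \<eta> \<le> norm (f + (u i - u j))"
    by blast
  define x where "x = u i - u j"
  have orth: "norm f - \<eta> \<le> norm (f + x)" if "f \<in> span B" "norm f \<le> R" for f
    using orth[of f] that by (simp add: x_def)
  have xD: "x \<in> D" unfolding x_def using u D by (intro subspace_diff)
  have x_ge: "e \<le> norm x" using e(2)[OF ij(2)] by (simp add: x_def dist_norm norm_minus_commute)
  have x_le: "norm x \<le> 2 * c" unfolding x_def
    using norm_triangle_ineq4[of "u i" "u j"] u(2)[of i] u(2)[of j] by linarith
  have qx: "q x \<le> \<tau>"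
    unfolding x_def using q_diff[OF u(1) u(1), of i j] N[of i] N[of j] ij by simp
  have R: "2 * c \<le> R" using c ab by (simp add: R_def)
  have x_notin: "x \<notin> span B"
  proof
    assume "x \<in> span B"
    then have "- x \<in> span B" by (rule span_neg)
    then have "norm (- x) - \<eta> \<le> norm (- x + x)"
      using x_le R by (intro orth) auto
    then show False using \<eta>_le e x_ge by simp
  qed
  have plus: "q (f + x) \<le> b * norm (f + x)" if f: "f \<in> span B" for f
  proof -
    have 1: "q (f + x) \<le> a * norm f + \<tau>"
      using q_add[of f x] f spB xD small[OF f] qx by auto
    show ?thesis
    proof (cases "norm f \<le> R")
      case True
      then have 2: "norm f - \<eta> \<le> norm (f + x)" using orth f by blast
      have 3: "norm x - norm f \<le> norm (f + x)"
        by (metis add.commute norm_diff_ineq)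
      \<comment> \<open>Adding the two preceding bounds eliminates \<open>norm f\<close> and leaves
        \<open>norm x - \<eta> \<ge> e/2\<close> on one side.\<close>
      have "e/4 \<le> norm (f + x)" using 2 3 x_ge \<eta>_le by linarith
      then have "(b - a) * (e/4) \<le> (b - a) * norm (f + x)" using ab by (intro mult_left_mono) auto
      moreover have "a * norm f \<le> a * (norm (f + x) + \<eta>)" using 2 ab by (intro mult_left_mono) auto
      moreover have "(b - a) * e > 0" using ab e by simp
      moreover have "(b - a) * (e/4) = (b - a) * e / 4"
        "(b - a) * norm (f + x) = b * norm (f + x) - a * norm (f + x)"
        "a * (norm (f + x) + \<eta>) = a * norm (f + x) + a * \<eta>"
        by (simp_all add: algebra_simps)
      ultimately show ?thesis using 1 a\<eta> \<tau> by linarith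
    next
      case False
      \<comment> \<open>Far from the origin almost orthogonality is replaced by
        \<open>norm x \<le> 2 * c\<close>, and the summand 1 in \<open>R\<close> pays for
        \<open>\<tau> \<le> 1\<close>.\<close>
      then have "(1 + 2 * c * b) / (b - a) \<le> norm f" using c by (simp add: R_def)
      then have 2: "1 + 2 * c * b \<le> (b - a) * norm f"
        using ab by (simp add: pos_divide_le_eq mult.commute)
      have "norm f - 2 * c \<le> norm (f + x)" using norm_diff_ineq[of f x] x_le by linarith
      then have "b * (norm f - 2 * c) \<le> b * norm (f + x)" using ab by (intro mult_left_mono) auto
      then show ?thesis using 1 2 \<tau> by (simp add: algebra_simps)
    qed
  qed
  have "q y \<le> b * norm y" if y: "y \<in> span (insert x B)" for y
  proof -
    obtain k where k: "y - s k x \<in> span B" using y by (auto simp: span_insert)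
    show ?thesis
    proof (cases "k = 0")
      case True
      then have "q y \<le> a * norm y" using k small by simp
      also have "\<dots> \<le> b * norm y" using ab by (intro mult_right_mono) auto
      finally show ?thesis .
    next
      case False
      define f where "f = s (inverse k) (y - s k x)"
      have f: "f \<in> span B" unfolding f_def using k by (rule span_scale)
      have yeq: "y = s k (f + x)"
        using False by (simp add: f_def scale_right_distrib scale_right_diff_distrib)
      have "f + x \<in> D" using f spB xD D by (blast intro: subspace_add)
      then have "q y = norm k * q (f + x)" unfolding yeq by (rule q_scale)
      also have "\<dots> \<le> norm k * (b * norm (f + x))" using plus[OF f] by (intro mult_left_mono) auto
      finally show ?thesis by (simp add: yeq mult.left_commute)
    qed
  qed
  then show thesis using that xD x_notin by blast
qed

text \<open>The union of an increasing chain of spans, each extending the previous one by one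
  dimension.\<close>

lemma infinite_dimensional_small_subspace:
  assumes \<delta>: "\<delta> > 0"
    and u: "\<And>n. u n \<in> D" "\<And>n. norm (u n) \<le> c"
    and e: "0 < e" "\<And>i j. i < j \<Longrightarrow> e \<le> dist (u j) (u i)"
    and lim: "(\<lambda>n. q (u n)) \<longlonglongrightarrow> 0"
  obtains V where "subspace V" "V \<subseteq> D" "edim s V = \<infinity>" "\<And>v. v \<in> V \<Longrightarrow> q v \<le> \<delta> * norm v"
proof -
  \<comment> \<open>These constants start at 0, where the span is trivial, and increase strictly
    while staying below \<open>\<delta>\<close>, so every extension has a positive gap to
    spend.\<close>
  define a where "a = (\<lambda>k::nat. \<delta> * (real k / (real k + 1)))"
  define P where "P = (\<lambda>k B. finite B \<and> independent B \<and> card B = k \<and> B \<subseteq> D \<and>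
    (\<forall>y\<in>span B. q y \<le> a k * norm y))"
  have "\<exists>B. \<forall>k. P k (B k) \<and> B k \<subseteq> B (Suc k)"
  proof (rule dependent_nat_choice)
    show "\<exists>B. P 0 B" by (rule exI[of _ "{}"]) (simp add: P_def q_zero independent_empty)
    fix B and k assume "P k B"
    then have B: "finite B" "independent B" "card B = k" "B \<subseteq> D" "\<And>y. y \<in> span B \<Longrightarrow> q y \<le> a k * norm y"
      by (auto simp: P_def)
    have a: "0 \<le> a k" "a k < a (Suc k)" using \<delta> by (auto simp: a_def field_simps)
    obtain x where x: "x \<in> D" "x \<notin> span B" "\<And>y. y \<in> span (insert x B) \<Longrightarrow> q y \<le> a (Suc k) * norm y"
      using extend_small_span[OF B(1,4,5) a u e lim] by blast
    have "x \<notin> B" using x(2) span_base by blast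
    then have "P (Suc k) (insert x B)"
      using B x by (simp add: P_def independent_insertI)
    then show "\<exists>C. P (Suc k) C \<and> B \<subseteq> C" by blast
  qed
  then obtain B where B: "\<And>k. P k (B k)" "\<And>k. B k \<subseteq> B (Suc k)" by blast
  have mono: "span (B i) \<subseteq> span (B j)" if "i \<le> j" for i j
    using lift_Suc_mono_le[of B, OF B(2) that] by (rule span_mono)
  define V where "V = (\<Union>k. span (B k))"
  show thesis
  proof
    show "subspace V"
    proof (rule subspaceI)
      show "0 \<in> V" by (auto simp: V_def span_zero)
      fix x y assume "x \<in> V" "y \<in> V"
      then obtain i j where "x \<in> span (B i)" "y \<in> span (B j)" by (auto simp: V_def)
      then have "x \<in> span (B (max i j))" "y \<in> span (B (max i j))"
        using mono[of i "max i j"] mono[of j "max i j"] by auto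
      then have "x + y \<in> span (B (max i j))" by (rule span_add)
      then show "x + y \<in> V" by (auto simp: V_def)
    qed (auto simp: V_def intro: span_scale)
    have "span (B k) \<subseteq> D" for k using B(1)[of k] D by (intro span_minimal) (auto simp: P_def)
    then show "V \<subseteq> D" by (auto simp: V_def)
    have le: "enat k \<le> edim s V" for k
    proof -
      have "B k \<subseteq> V" unfolding V_def using span_superset[of "B k"] by blast
      then show ?thesis using card_le_edim[of "B k" V] B(1)[of k] by (simp add: P_def)
    qed
    show "edim s V = \<infinity>"
    proof (cases "edim s V")
      case (enat n)
      then show ?thesis using le[of "Suc n"] by simp
    qed
    fix v assume "v \<in> V"
    then obtain k where k: "v \<in> span (B k)" by (auto simp: V_def)
    have "q v \<le> a k * norm v" using B(1)[of k] k by (auto simp: P_def)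
    also have "\<dots> \<le> \<delta> * norm v" using \<delta> by (intro mult_right_mono) (auto simp: a_def field_simps)
    finally show "q v \<le> \<delta> * norm v" .
  qed
qed

end

section \<open>Closed operators\<close>

locale closed_op = X: banach_over sX + Y: banach_over sY
  for sX :: "'k::{real_normed_field,euclidean_space} \<Rightarrow> 'a::banach \<Rightarrow> 'a"
    and sY :: "'k \<Rightarrow> 'b::banach \<Rightarrow> 'b" +
  fixes A :: "('a, 'b) partial_op"
  assumes closed_A: "closed_operator sX sY A"
begin

section \<open>Linearity and the closed graph of a partial operator\<close>

abbreviation D :: "'a set" where "D \<equiv> op_dom A"
abbreviation T :: "'a \<Rightarrow> 'b" where "T \<equiv> op_app A"

lemma subspace_dom: "X.subspace D"
  using closed_A by (simp add: closed_operator_def)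

lemma app_add: "x \<in> D \<Longrightarrow> y \<in> D \<Longrightarrow> T (x + y) = T x + T y"
  using closed_A by (simp add: closed_operator_def)

lemma app_scale: "x \<in> D \<Longrightarrow> T (sX c x) = sY c (T x)"
  using closed_A by (simp add: closed_operator_def)

lemma app_scaleR: "x \<in> D \<Longrightarrow> T (r *\<^sub>R x) = r *\<^sub>R T x"
  using app_scale[of x "of_real r"] by (simp add: X.s_of_real Y.s_of_real)

lemma zero_in_dom: "0 \<in> D"
  using X.subspace_0[OF subspace_dom] .

lemma app_zero [simp]: "T 0 = 0"
  using app_scale[OF zero_in_dom, of 0] by simp

lemma app_diff: "x \<in> D \<Longrightarrow> y \<in> D \<Longrightarrow> T (x - y) = T x - T y"
  using app_add[of x "- 1 *\<^sub>R y"] X.subspace_scaleR[OF subspace_dom, of y "- 1"]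
    app_scaleR[of y "- 1"] by simp

lemma dom_diff: "x \<in> D \<Longrightarrow> y \<in> D \<Longrightarrow> x - y \<in> D"
  by (rule X.subspace_diff[OF subspace_dom])

lemma dom_add: "x \<in> D \<Longrightarrow> y \<in> D \<Longrightarrow> x + y \<in> D"
  by (rule X.subspace_add[OF subspace_dom])

lemma dom_scaleR: "x \<in> D \<Longrightarrow> r *\<^sub>R x \<in> D"
  by (rule X.subspace_scaleR[OF subspace_dom])

lemma subspace_range: "Y.subspace (op_range A)"
proof (rule Y.subspaceI)
  show "0 \<in> op_range A" unfolding op_range_def by (rule image_eqI[OF _ zero_in_dom]) simp
  show "x + y \<in> op_range A" if "x \<in> op_range A" "y \<in> op_range A" for x y
    using that by (auto simp: op_range_def app_add[symmetric] intro!: imageI dom_add)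
  show "sY c x \<in> op_range A" if "x \<in> op_range A" for c x
    using that
    by (auto simp: op_range_def app_scale[symmetric] intro!: imageI X.subspace_scale[OF subspace_dom])
qed

lemma subspace_ker: "X.subspace (op_ker A)"
  by (rule X.subspaceI)
    (auto simp: op_ker_def zero_in_dom dom_add app_add app_scale X.subspace_scale[OF subspace_dom])

lemma graph_limit:
  assumes "\<And>n. x n \<in> D" "x \<longlonglongrightarrow> l" "(\<lambda>n. T (x n)) \<longlonglongrightarrow> m"
  shows "l \<in> D" "T l = m"
proof -
  have "closed (op_graph A)" using closed_A by (simp add: closed_operator_def)
  moreover have "\<And>n. (x n, T (x n)) \<in> op_graph A" using assms(1) by (auto simp: op_graph_def)
  moreover have "(\<lambda>n. (x n, T (x n))) \<longlonglongrightarrow> (l, m)" using assms by (intro tendsto_Pair)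
  ultimately have "(l, m) \<in> op_graph A" by (rule closed_sequentially)
  then show "l \<in> D" "T l = m" by (auto simp: op_graph_def)
qed

lemma closed_ker: "closed (op_ker A)"
  unfolding closed_sequential_limits
proof safe
  fix x l assume x: "\<forall>n. x n \<in> op_ker A" "x \<longlonglongrightarrow> l"
  then have "l \<in> D" "T l = 0" using graph_limit[of x l 0] by (auto simp: op_ker_def)
  then show "l \<in> op_ker A" by (simp add: op_ker_def)
qed

text \<open>Partial sums are mapped to \<open>z 0 - z N\<close> by telescoping, and the closed graph
  carries this to the limit. Both successive approximation arguments below rest on it.\<close>

lemma series_preimage:
  assumes w: "\<And>n. w n \<in> D" "summable (\<lambda>n. norm (w n))"
    and z: "\<And>n. T (w n) = z n - z (Suc n)" "z \<longlonglongrightarrow> l"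
  shows "suminf w \<in> D" "T (suminf w) = z 0 - l"
proof -
  have part: "sum w {..<N} \<in> D \<and> T (sum w {..<N}) = z 0 - z N" for N
    by (induction N) (auto simp: zero_in_dom dom_add app_add w z)
  have "(\<lambda>N. sum w {..<N}) \<longlonglongrightarrow> suminf w"
    using summable_LIMSEQ[OF summable_norm_cancel[OF w(2)]] .
  moreover have "(\<lambda>N. T (sum w {..<N})) \<longlonglongrightarrow> z 0 - l"
    using part z(2) by (auto intro!: tendsto_intros)
  ultimately show "suminf w \<in> D" "T (suminf w) = z 0 - l"
    using graph_limit[of "\<lambda>N. sum w {..<N}"] part by blast+
qed

text \<open>A limit \<open>l\<close> of the range is approached geometrically by \<open>z n\<close>.
  Bounded preimages of the successive differences form an absolutely convergent series, whose sum is
  a preimage of \<open>z 0 - l\<close>.\<close>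

lemma closed_range_if_bounded_preimages:
  assumes pre: "\<And>y. y \<in> op_range A \<Longrightarrow> \<exists>x\<in>D. T x = y \<and> norm x \<le> c * norm y"
  shows "closed (op_range A)"
proof -
  have "l \<in> op_range A" if l: "l \<in> closure (op_range A)" for l
  proof -
    have "\<exists>y\<in>op_range A. dist y l < (1/2) ^ n" for n :: nat
      using l unfolding closure_approachable by simp
    then obtain z where z: "\<And>n::nat. z n \<in> op_range A" "\<And>n. dist (z n) l < (1/2) ^ n" by metis
    have zdiff: "z n - z (Suc n) \<in> op_range A" for n
      by (intro Y.subspace_diff[OF subspace_range] z)
    obtain w where w: "\<And>n. w n \<in> D" "\<And>n. T (w n) = z n - z (Suc n)"
      "\<And>n. norm (w n) \<le> c * norm (z n - z (Suc n))"
      using pre[OF zdiff] by metis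
    have zn: "norm (z n - z (Suc n)) \<le> 2 * (1/2) ^ n" for n
    proof -
      have "norm (z n - z (Suc n)) \<le> dist (z n) l + dist (z (Suc n)) l"
        using dist_triangle2[of "z n" "z (Suc n)" l] by (simp add: dist_norm)
      moreover have "(1/2) ^ Suc n \<le> ((1/2) ^ n :: real)" by simp
      ultimately show ?thesis using z(2)[of n] z(2)[of "Suc n"] by linarith
    qed
    \<comment> \<open>The sign of \<open>c\<close> is unrestricted, hence the absolute
      value.\<close>
    have wn: "norm (w n) \<le> \<bar>c\<bar> * 2 * (1/2) ^ n" for n
    proof -
      have "norm (w n) \<le> \<bar>c\<bar> * norm (z n - z (Suc n))"
        using w(3)[of n] by (meson abs_ge_self mult_right_mono norm_ge_zero order_trans)
      also have "\<dots> \<le> \<bar>c\<bar> * (2 * (1/2) ^ n)" using zn by (intro mult_left_mono) auto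
      finally show ?thesis by simp
    qed
    have "summable (\<lambda>n. \<bar>c\<bar> * 2 * (1/2::real) ^ n)"
      by (intro summable_mult summable_geometric) simp
    then have "summable (\<lambda>n. norm (w n))"
      by (rule summable_comparison_test'[of _ 0]) (use wn in simp)
    moreover have "z \<longlonglongrightarrow> l"
    proof (rule metric_LIMSEQ_I)
      fix r :: real assume "r > 0"
      then obtain N where N: "(1/2) ^ N < r" using real_arch_pow_inv[of r "1/2"] by auto
      have "dist (z n) l < r" if "n \<ge> N" for n
      proof -
        have "(1/2) ^ n \<le> ((1/2) ^ N :: real)" by (rule power_decreasing) (use that in auto)
        then show ?thesis using z(2)[of n] N by linarith
      qed
      then show "\<exists>N. \<forall>n\<ge>N. dist (z n) l < r" by blast
    qed
    ultimately have "suminf w \<in> D" "T (suminf w) = z 0 - l"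
      using series_preimage[of w z l] w by auto
    then have "z 0 - l \<in> op_range A" by (metis image_eqI op_range_def)
    then have "z 0 - (z 0 - l) \<in> op_range A" by (rule Y.subspace_diff[OF subspace_range z(1)])
    then show ?thesis by simp
  qed
  then show ?thesis by (metis closure_subset closure_eq subsetI subset_antisym)
qed

text \<open>Each correction halves the residual, so the corrections sum to an exact preimage; the
  geometric series gives the factor 2.\<close>

lemma exact_preimages_from_approximate:
  assumes approx: "\<And>y. y \<in> op_range A \<Longrightarrow> \<exists>x\<in>D. norm x \<le> c * norm y \<and> norm (y - T x) \<le> norm y / 2"
    and c: "c \<ge> 0" and y: "y \<in> op_range A"
  shows "\<exists>x\<in>D. T x = y \<and> norm x \<le> 2 * c * norm y"
proof -
  obtain g where g: "\<And>z. z \<in> op_range A \<Longrightarrow> g z \<in> D" "\<And>z. z \<in> op_range A \<Longrightarrow> norm (g z) \<le> c * norm z"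
    "\<And>z. z \<in> op_range A \<Longrightarrow> norm (z - T (g z)) \<le> norm z / 2"
    using approx by metis
  \<comment> \<open>\<open>z n\<close> is the residual after \<open>n\<close> corrections.\<close>
  define z where "z = (\<lambda>n. ((\<lambda>v. v - T (g v)) ^^ n) y)"
  have zS: "z (Suc n) = z n - T (g (z n))" for n by (simp add: z_def)
  have z: "z n \<in> op_range A \<and> norm (z n) \<le> norm y * (1/2) ^ n" for n
  proof (induction n)
    case 0
    then show ?case using y by (simp add: z_def)
  next
    case (Suc n)
    then have "T (g (z n)) \<in> op_range A" using g(1) by (simp add: op_range_def)
    then have "z (Suc n) \<in> op_range A" unfolding zS
      using Suc by (intro Y.subspace_diff[OF subspace_range]) auto
    moreover have "norm (z (Suc n)) \<le> norm (z n) / 2" unfolding zS using g(3) Suc by blast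
    ultimately show ?case using Suc by simp
  qed
  define w where "w = (\<lambda>n. g (z n))"
  have w: "w n \<in> D" "T (w n) = z n - z (Suc n)" for n using g(1) z by (auto simp: w_def zS)
  have wn: "norm (w n) \<le> c * norm y * (1/2) ^ n" for n
  proof -
    have "norm (w n) \<le> c * norm (z n)" unfolding w_def using g(2) z by blast
    also have "\<dots> \<le> c * (norm y * (1/2) ^ n)" using z c by (intro mult_left_mono) auto
    finally show ?thesis by simp
  qed
  have geo: "(\<lambda>n. c * norm y * (1/2) ^ n) sums (c * norm y * 2)"
    using sums_mult[OF geometric_sums[of "1/2::real"], of "c * norm y"] by simp
  have sw: "summable (\<lambda>n. norm (w n))"
    by (rule summable_comparison_test'[OF sums_summable[OF geo], of 0]) (use wn in simp)
  have "z \<longlonglongrightarrow> 0"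
  proof (rule Lim_null_comparison)
    show "(\<lambda>n. norm y * (1/2) ^ n) \<longlonglongrightarrow> 0"
      using tendsto_mult_right_zero[OF LIMSEQ_power_zero[of "1/2::real"], of "norm y"] by simp
    show "\<forall>\<^sub>F n in sequentially. norm (z n) \<le> norm y * (1/2) ^ n" using z by simp
  qed
  then have "suminf w \<in> D" "T (suminf w) = y"
    using series_preimage[of w z 0] w sw by (auto simp: z_def)
  moreover have "norm (suminf w) \<le> 2 * c * norm y"
  proof -
    have "norm (suminf w) \<le> (\<Sum>n. norm (w n))" by (rule summable_norm[OF sw])
    also have "\<dots> \<le> (\<Sum>n. c * norm y * (1/2) ^ n)"
      using wn sw sums_summable[OF geo] by (intro suminf_le) auto
    finally show ?thesis using sums_unique[OF geo] by simp
  qed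
  ultimately show ?thesis by blast
qed

text \<open>The open mapping theorem, with the Baire category theorem applied inside the closed range.\<close>

lemma closed_range_imp_bounded_preimages:
  assumes cl: "closed (op_range A)"
  obtains c where "c \<ge> 0" "\<And>y. y \<in> op_range A \<Longrightarrow> \<exists>x\<in>D. T x = y \<and> norm x \<le> c * norm y"
proof -
  let ?R = "op_range A"
  let ?X = "top_of_set ?R"
  \<comment> \<open>These closed sets cover the closed range, so by Baire one of them has interior
    relative to it.\<close>
  define C where "C = (\<lambda>n::nat. closure (T ` (D \<inter> cball 0 (real n))))"
  have CR: "C n \<subseteq> ?R" for n
    unfolding C_def using cl by (intro closure_minimal) (auto simp: op_range_def)
  have "\<exists>n. ?X interior_of C n \<noteq> {}"
  proof (rule ccontr)
    assume no: "\<not> ?thesis"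
    have "completely_metrizable_space ?X"
      using cl completely_metrizable_space_closedin[OF completely_metrizable_space_euclidean]
      by (metis closed_closedin)
    moreover have "closedin ?X S \<and> ?X interior_of S = {}" if S_in: "S \<in> range C" for S
    proof -
      obtain n where S: "S = C n" using S_in by blast
      have "closed (C n)" unfolding C_def by (rule closed_closure)
      then show ?thesis using closed_subset[OF CR[of n]] no S by simp
    qed
    moreover have "countable (range C)" by simp
    ultimately have "?X interior_of (\<Union>(range C)) = {}"
      using Baire_category_alt[of ?X "range C"] by blast
    moreover have "\<Union>(range C) = ?R"
    proof
      show "\<Union>(range C) \<subseteq> ?R" using CR by blast
      show "?R \<subseteq> \<Union>(range C)"
      proof
        fix y assume "y \<in> ?R"
        then obtain x where x: "x \<in> D" "y = T x" by (auto simp: op_range_def)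
        obtain n :: nat where "norm x \<le> real n" using real_arch_simple by blast
        then have "y \<in> T ` (D \<inter> cball 0 (real n))" using x by auto
        then have "y \<in> C n" unfolding C_def by (rule closure_subset[THEN subsetD])
        then show "y \<in> \<Union>(range C)" by blast
      qed
    qed
    moreover have "?X interior_of ?R = ?R" by (intro interior_of_openin) auto
    ultimately show False using Y.subspace_0[OF subspace_range] by auto
  qed
  then obtain n U where U: "openin ?X U" "U \<subseteq> C n" "U \<noteq> {}"
    by (auto simp: interior_of_eq_empty)
  then obtain y0 where y0: "y0 \<in> U" by blast
  then have y0R: "y0 \<in> ?R" using U CR by blast
  obtain e where e: "e > 0" "\<And>y. y \<in> ?R \<Longrightarrow> dist y y0 < e \<Longrightarrow> y \<in> C n"
    using U y0 unfolding openin_euclidean_subtopology_iff by blast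
  \<comment> \<open>Two preimages of norm at most \<open>n\<close>, subtracted and divided by the
    \<open>t\<close> chosen below, have norm at most \<open>2 * real n / t\<close>, which is
    \<open>c * norm y\<close>.\<close>
  define c where "c = 4 * real n / e"
  have "\<exists>x\<in>D. norm x \<le> c * norm y \<and> norm (y - T x) \<le> norm y / 2" if y: "y \<in> ?R" for y
  proof (cases "y = 0")
    case True
    then show ?thesis using zero_in_dom by (intro bexI[of _ 0]) auto
  next
    case False
    \<comment> \<open>Scaled by \<open>t\<close>, the vector \<open>y\<close> moves
      \<open>y0\<close> by \<open>e/2\<close> only, so both points lie in \<open>C n\<close>.
      Approximating each within \<open>e/8\<close> gives a total error of at most
      \<open>e/4\<close>, which is \<open>t * (norm y / 2)\<close>.\<close>
    define t where "t = e / (2 * norm y)"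
    have t: "t > 0" "t * norm y = e / 2" using False e by (auto simp: t_def)
    have "y0 + t *\<^sub>R y \<in> ?R"
      by (intro Y.subspace_add[OF subspace_range] Y.subspace_scaleR[OF subspace_range] y y0R)
    then have "y0 + t *\<^sub>R y \<in> C n" using e t by (auto simp: dist_norm)
    moreover have "y0 \<in> C n" using U y0 by blast
    moreover have "\<exists>x. x \<in> D \<and> norm x \<le> real n \<and> dist (T x) z < e/8" if z: "z \<in> C n" for z
    proof -
      have "e/8 > 0" using e(1) by simp
      then obtain v where "v \<in> T ` (D \<inter> cball 0 (real n))" "dist v z < e/8"
        using z unfolding C_def closure_approachable by blast
      then show ?thesis by auto
    qed
    ultimately obtain x1 x2 where x: "x1 \<in> D" "norm x1 \<le> real n" "dist (T x1) (y0 + t *\<^sub>R y) < e/8"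
      "x2 \<in> D" "norm x2 \<le> real n" "dist (T x2) y0 < e/8"
      by meson
    define x where "x = (1 / t) *\<^sub>R (x1 - x2)"
    have xD: "x \<in> D" unfolding x_def by (intro dom_scaleR dom_diff x)
    have "T x = (1 / t) *\<^sub>R (T x1 - T x2)"
      unfolding x_def by (simp only: app_scaleR app_diff dom_diff x(1,4))
    then have "t *\<^sub>R (y - T x) = (y0 + t *\<^sub>R y - T x1) - (y0 - T x2)"
      using t by (simp add: scaleR_diff_right)
    then have "norm (t *\<^sub>R (y - T x)) \<le> norm (y0 + t *\<^sub>R y - T x1) + norm (y0 - T x2)"
      by (metis norm_triangle_ineq4)
    also have "\<dots> \<le> e/4" using x(3,6) by (simp add: dist_norm norm_minus_commute)
    finally have "norm (t *\<^sub>R (y - T x)) \<le> e/4" .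
    moreover have "norm (t *\<^sub>R (y - T x)) = t * norm (y - T x)" using t(1) by simp
    moreover have "e/4 = t * (norm y / 2)" using t(2) by simp
    ultimately have "t * norm (y - T x) \<le> t * (norm y / 2)" by linarith
    then have 1: "norm (y - T x) \<le> norm y / 2" using t by (simp only: mult_le_cancel_left_pos)
    have "norm x = norm (x1 - x2) / t" using t by (simp add: x_def)
    also have "\<dots> \<le> (2 * real n) / t"
      using norm_triangle_ineq4[of x1 x2] x t by (intro divide_right_mono) auto
    also have "\<dots> = c * norm y" using e False by (simp add: c_def t_def)
    finally show ?thesis using xD 1 by blast
  qed
  moreover have "c \<ge> 0" using e by (simp add: c_def)
  ultimately show thesis
    using that[of "2 * c"] exact_preimages_from_approximate[of c] by simp
qed

text \<open>Either the kernel is infinite-dimensional and contains separated unit vectors, or the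
  range is not closed and preimages cannot be bounded. In the second case vectors away from the
  kernel have images tending to 0, and the closed graph excludes convergent subsequences.\<close>

lemma separated_approximate_kernel:
  assumes "\<not> lower_semi_Fredholm sX sY A"
  obtains u e where "e > 0" "\<And>n::nat. u n \<in> D" "\<And>n. norm (u n) \<le> 2"
    "\<And>i j. i < j \<Longrightarrow> e \<le> dist (u j) (u i)" "(\<lambda>n. norm (T (u n))) \<longlonglongrightarrow> 0"
proof (cases "edim sX (op_ker A) < \<infinity>")
  case False
  then have inf: "edim sX (op_ker A) = \<infinity>" by simp
  have "\<exists>n>N. \<exists>x. (x \<in> op_ker A \<and> norm x = 1) \<and> (\<forall>y\<in>K. 1/4 \<le> dist x y)" if "finite K" for K and N :: nat
  proof -
    have "enat (Suc (card K)) \<le> edim sX (op_ker A)" using inf by simp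
    then obtain x where x: "x \<in> op_ker A" "norm x = 1" "\<And>y. y \<in> K \<Longrightarrow> 1/4 \<le> dist x y"
      using X.unit_vector_away_from_finite[OF subspace_ker \<open>finite K\<close>] by blast
    show ?thesis
    proof (intro exI conjI ballI)
      show "N < Suc N" by simp
    qed (fact x)+
  qed
  then obtain r :: "nat \<Rightarrow> nat" and x where "strict_mono r" and x: "\<And>i::nat. x i \<in> op_ker A \<and> norm (x i) = 1"
      "\<And>i j. i < j \<Longrightarrow> 1/4 \<le> dist (x j) (x i)"
    using separated_sequence[of "\<lambda>n x. x \<in> op_ker A \<and> norm x = 1" "1/4"] by blast
  then show thesis using that[of "1/4" x] by (simp add: op_ker_def)
next
  case True
  then have "\<not> closed (op_range A)"
    using assms closed_A by (simp add: lower_semi_Fredholm_def)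
  then have no_bound: "\<exists>y\<in>op_range A. \<forall>x\<in>D. T x = y \<longrightarrow> c * norm y < norm x" for c
    using closed_range_if_bounded_preimages[of c] by (meson not_le)
  have "\<exists>v\<in>D. norm v \<le> 2 \<and> (\<forall>k\<in>op_ker A. 1 \<le> dist v k) \<and> norm (T v) \<le> inverse (real (Suc n))" for n
  proof -
    obtain x where x: "x \<in> D" and far: "\<And>x'. x' \<in> D \<Longrightarrow> T x' = T x \<Longrightarrow> real (Suc n) * norm (T x) < norm x'"
      using no_bound[of "real (Suc n)"] by (auto simp: op_range_def)
    have "T x \<noteq> 0" using far[OF zero_in_dom] by auto
    then have xk: "x \<notin> op_ker A" by (simp add: op_ker_def)
    have ne: "op_ker A \<noteq> {}" using X.subspace_0[OF subspace_ker] by blast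
    define d where "d = infdist x (op_ker A)"
    have d: "d > 0" using infdist_pos_not_in_closed[OF closed_ker ne xk] by (simp add: d_def)
    \<comment> \<open>Subtracting a kernel vector gives another preimage of the same point, so the
      failed norm bound becomes a lower bound on the distance to the kernel.\<close>
    have "real (Suc n) * norm (T x) \<le> dist x k" if "k \<in> op_ker A" for k
      using far[of "x - k"] that x by (auto simp: op_ker_def dom_diff app_diff dist_norm intro: less_imp_le)
    then have d_ge: "real (Suc n) * norm (T x) \<le> d"
      unfolding d_def infdist_notempty[OF ne] using ne by (intro cINF_greatest)
    obtain k where k: "k \<in> op_ker A" "dist x k < 2 * d"
      using infdist_lessD[OF ne, of x "2 * d"] d by (auto simp: d_def)
    then have kD: "k \<in> D" "T k = 0" by (auto simp: op_ker_def)
    \<comment> \<open>Removing a nearly closest kernel vector and dividing by the distance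
      \<open>d\<close> yields norm at most 2, distance at least 1 from the kernel, and an image of
      norm at most \<open>1 / (n + 1)\<close>.\<close>
    define v where "v = (1 / d) *\<^sub>R (x - k)"
    have "v \<in> D" unfolding v_def by (intro dom_scaleR dom_diff x kD)
    moreover have "norm v \<le> 2" using k d by (simp add: v_def dist_norm pos_divide_le_eq)
    moreover have "1 \<le> dist v k'" if k': "k' \<in> op_ker A" for k'
    proof -
      have "k + d *\<^sub>R k' \<in> op_ker A"
        by (intro X.subspace_add[OF subspace_ker] X.subspace_scaleR[OF subspace_ker] k k')
      then have "d \<le> dist x (k + d *\<^sub>R k')" unfolding d_def by (rule infdist_le)
      also have "x - (k + d *\<^sub>R k') = d *\<^sub>R (v - k')" using d by (simp add: v_def algebra_simps)
      then have "dist x (k + d *\<^sub>R k') = d * dist v k'" using d by (simp add: dist_norm)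
      finally show ?thesis using d by simp
    qed
    moreover have "norm (T v) = norm (T x) / d"
      using d x kD by (simp add: v_def app_scaleR app_diff dom_diff)
    then have "real (Suc n) * norm (T v) \<le> 1"
      using d d_ge by (simp add: pos_divide_le_eq del: of_nat_Suc)
    then have "norm (T v) \<le> inverse (real (Suc n))"
      by (simp add: inverse_eq_divide pos_le_divide_eq mult.commute del: of_nat_Suc)
    ultimately show ?thesis by blast
  qed
  then obtain v where v: "\<And>n. v n \<in> D" "\<And>n. norm (v n) \<le> 2" "\<And>n k. k \<in> op_ker A \<Longrightarrow> 1 \<le> dist (v n) k"
    "\<And>n. norm (T (v n)) \<le> inverse (real (Suc n))"
    by metis
  have Tv: "(\<lambda>n. T (v n)) \<longlonglongrightarrow> 0"
    by (rule Lim_null_comparison[OF _ LIMSEQ_inverse_real_of_nat]) (use v(4) in simp)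
  \<comment> \<open>A limit would be a kernel vector, from which all \<open>v n\<close> keep
    distance 1.\<close>
  have "\<not> (v \<circ> r) \<longlonglongrightarrow> l" if r: "strict_mono r" for r l
  proof
    assume lim: "(v \<circ> r) \<longlonglongrightarrow> l"
    moreover have "(\<lambda>n. T ((v \<circ> r) n)) \<longlonglongrightarrow> 0"
      using LIMSEQ_subseq_LIMSEQ[OF Tv r] by (simp add: o_def)
    ultimately have "l \<in> op_ker A" using graph_limit[of "v \<circ> r" l 0] v(1) by (simp add: op_ker_def)
    moreover obtain n where "dist ((v \<circ> r) n) l < 1"
      using metric_LIMSEQ_D[OF lim, of 1] by auto
    ultimately show False using v(3)[of l "r n"] by simp
  qed
  then obtain e and r :: "nat \<Rightarrow> nat" where er: "e > 0" "strict_mono r"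
    "\<And>i j. i < j \<Longrightarrow> e \<le> dist (v (r j)) (v (r i))"
    using separated_subsequence[of v] by blast
  have "(\<lambda>n. norm (T (v (r n)))) \<longlonglongrightarrow> 0"
    using tendsto_norm_zero[OF LIMSEQ_subseq_LIMSEQ[OF Tv er(2)]] by (simp add: o_def)
  then show thesis using that[of e "\<lambda>n. v (r n)"] er v by blast
qed

lemma infinite_dimensional_approximate_kernel:
  assumes "\<not> lower_semi_Fredholm sX sY A" "\<delta> > 0"
  obtains V where "X.subspace V" "V \<subseteq> D" "edim sX V = \<infinity>" "\<And>v. v \<in> V \<Longrightarrow> norm (T v) \<le> \<delta> * norm v"
proof -
  obtain u e where u: "e > 0" "\<And>n::nat. u n \<in> D" "\<And>n. norm (u n) \<le> 2"
    "\<And>i j. i < j \<Longrightarrow> e \<le> dist (u j) (u i)" "(\<lambda>n. norm (T (u n))) \<longlonglongrightarrow> 0"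
    by (rule separated_approximate_kernel[OF assms(1)], rule that)
  interpret q: subspace_seminorm sX D "\<lambda>x. norm (T x)"
    by unfold_locales (auto simp: subspace_dom app_add app_scale norm_triangle_ineq)
  show thesis
    by (rule q.infinite_dimensional_small_subspace[OF assms(2) u(2,3,1,4,5)]) (assumption | rule that)+
qed

end

section \<open>Subspaces of graphs\<close>

text \<open>The Euclidean class norm serves here: from this structure come subspaces, dimensions and
  closures of the product, while adjustment is measured by \<open>max_norm\<close>.\<close>

lemma banach_space_over_prod:
  assumes "banach_space_over sX" "banach_space_over sY"
  shows "banach_space_over (module_prod.scale sX sY)"
proof -
  interpret X: banach_over sX by (rule banach_over.intro) fact
  interpret Y: banach_over sY by (rule banach_over.intro) fact
  interpret vector_space_prod sX sY ..
  show ?thesis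
    unfolding banach_space_over_def
  proof (intro conjI allI)
    show "vector_space scale" ..
    show "norm (scale c p) = norm c * norm p" for c p
      by (simp add: scale_def norm_prod_def power_mult_distrib real_sqrt_mult flip: distrib_left)
    show "scale (of_real r) p = r *\<^sub>R p" for r p
      by (simp add: scale_def X.s_of_real Y.s_of_real scaleR_prod_def)
  qed
qed

section \<open>Graphs over subspaces of the domain\<close>

context closed_op
begin

abbreviation sP :: "'k \<Rightarrow> 'a \<times> 'b \<Rightarrow> 'a \<times> 'b" where "sP \<equiv> module_prod.scale sX sY"

lemma sP_def: "sP c p = (sX c (fst p), sY c (snd p))"
proof -
  interpret vector_space_prod sX sY ..
  show ?thesis by (rule scale_def)
qed

sublocale P: banach_over sP
  by (rule banach_over.intro) (rule banach_space_over_prod[OF X.banach Y.banach])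

lemma subspace_graph_image:
  assumes V: "X.subspace V" "V \<subseteq> D"
  shows "P.subspace ((\<lambda>x. (x, T x)) ` V)"
proof (rule P.subspaceI)
  show "0 \<in> (\<lambda>x. (x, T x)) ` V"
    by (rule image_eqI[of _ _ 0]) (auto simp: zero_prod_def X.subspace_0[OF V(1)])
  fix p q assume "p \<in> (\<lambda>x. (x, T x)) ` V" "q \<in> (\<lambda>x. (x, T x)) ` V"
  then obtain x y where "x \<in> V" "y \<in> V" "p = (x, T x)" "q = (y, T y)" by blast
  moreover from this have "x \<in> D" "y \<in> D" using V(2) by auto
  ultimately show "p + q \<in> (\<lambda>x. (x, T x)) ` V"
    by (intro image_eqI[of _ _ "x + y"]) (auto simp: app_add X.subspace_add[OF V(1)])
next
  fix c p assume "p \<in> (\<lambda>x. (x, T x)) ` V"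
  then obtain x where "x \<in> V" "p = (x, T x)" by blast
  moreover from this have "x \<in> D" using V(2) by auto
  ultimately show "sP c p \<in> (\<lambda>x. (x, T x)) ` V"
    by (intro image_eqI[of _ _ "sX c x"])
      (auto simp: sP_def app_scale X.subspace_scale[OF V(1)])
qed

lemma subspace_graph: "P.subspace (op_graph A)"
proof -
  have "op_graph A = (\<lambda>x. (x, T x)) ` D" by (auto simp: op_graph_def)
  then show ?thesis using subspace_graph_image[OF subspace_dom] by simp
qed

text \<open>Neither the map into the graph nor the first projection back raises the
  dimension.\<close>

lemma edim_graph_image:
  assumes V: "X.subspace V" "V \<subseteq> D"
  shows "edim sP ((\<lambda>x. (x, T x)) ` V) = edim sX V"
proof (rule antisym)
  show "edim sP ((\<lambda>x. (x, T x)) ` V) \<le> edim sX V"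
    using V by (intro edim_image_le X.vector_space_axioms P.vector_space_axioms)
      (auto simp: sP_def app_add app_scale subset_iff)
  have "edim sX (fst ` (\<lambda>x. (x, T x)) ` V) \<le> edim sP ((\<lambda>x. (x, T x)) ` V)"
    by (intro edim_image_le X.vector_space_axioms P.vector_space_axioms subspace_graph_image V)
      (auto simp: sP_def)
  then show "edim sX V \<le> edim sP ((\<lambda>x. (x, T x)) ` V)" by (simp add: image_image)
qed

text \<open>Prepares test spaces for \<open>FSS_adjusted\<close>, which must have finite dimension;
  prescribing it exactly lets it be steered to infinity.\<close>

lemma finite_dimensional_graph_subspace:
  assumes V: "X.subspace V" "V \<subseteq> D" "enat m \<le> edim sX V"
    and small: "\<And>v. v \<in> V \<Longrightarrow> norm (T v) \<le> \<delta> * norm v"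
  obtains K where "P.subspace K" "K \<subseteq> op_graph A" "edim sP K = enat m"
    "\<And>p. p \<in> K \<Longrightarrow> norm (snd p) \<le> \<delta> * norm (fst p)"
proof -
  obtain B where B: "finite B" "X.independent B" "B \<subseteq> V" "card B = m"
    using X.independent_subset_of_edim[OF V(3)] by blast
  have W: "X.span B \<subseteq> V" using B(3) V(1) by (rule X.span_minimal)
  then have WD: "X.span B \<subseteq> D" using V(2) by blast
  show thesis
  proof
    show "P.subspace ((\<lambda>x. (x, T x)) ` X.span B)"
      by (rule subspace_graph_image[OF X.subspace_span WD])
    show "(\<lambda>x. (x, T x)) ` X.span B \<subseteq> op_graph A" using WD by (auto simp: op_graph_def)
    show "edim sP ((\<lambda>x. (x, T x)) ` X.span B) = enat m"
      using edim_graph_image[OF X.subspace_span WD] X.edim_span_independent[OF B(1,2)] B(4) by simp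
    show "norm (snd p) \<le> \<delta> * norm (fst p)" if "p \<in> (\<lambda>x. (x, T x)) ` X.span B" for p
      using that W small by auto
  qed
qed

text \<open>Test spaces for \<open>SS_adjusted\<close> must be closed. Graph and cone are both
  closed, so taking the closure leaves neither of them.\<close>

lemma infinite_dimensional_graph_subspace:
  assumes "\<not> lower_semi_Fredholm sX sY A" "\<delta> > 0"
  obtains K where "closed_subspace sP K" "K \<subseteq> op_graph A" "edim sP K = \<infinity>"
    "\<And>p. p \<in> K \<Longrightarrow> norm (snd p) \<le> \<delta> * norm (fst p)"
proof -
  obtain V where V: "X.subspace V" "V \<subseteq> D" "edim sX V = \<infinity>"
    "\<And>v. v \<in> V \<Longrightarrow> norm (T v) \<le> \<delta> * norm v"
    by (rule infinite_dimensional_approximate_kernel[OF assms], rule that)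
  let ?G = "(\<lambda>x. (x, T x)) ` V"
  let ?C = "{p :: 'a \<times> 'b. norm (snd p) \<le> \<delta> * norm (fst p)}"
  have "closed ?C" by (intro closed_Collect_le continuous_intros)
  moreover have "?G \<subseteq> ?C" using V(4) by auto
  ultimately have cone: "closure ?G \<subseteq> ?C" by (intro closure_minimal)
  show thesis
  proof (rule that[of "closure ?G"])
    show "closed_subspace sP (closure ?G)"
      unfolding closed_subspace_def
      by (intro conjI P.subspace_closure subspace_graph_image V closed_closure)
    have "?G \<subseteq> op_graph A" using V(2) by (auto simp: op_graph_def)
    moreover have "closed (op_graph A)" using closed_A by (simp add: closed_operator_def)
    ultimately show "closure ?G \<subseteq> op_graph A" by (rule closure_minimal)
    have "enat n \<le> edim sP (closure ?G)" for n
    proof -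
      have "enat n \<le> edim sP ?G" using edim_graph_image[OF V(1,2)] V(3) by simp
      then obtain B where B: "finite B" "P.independent B" "B \<subseteq> ?G" "card B = n"
        by (rule P.independent_subset_of_edim)
      have "B \<subseteq> closure ?G" using B(3) closure_subset[of ?G] by (rule subset_trans)
      then show ?thesis using P.card_le_edim[OF B(1,2)] B(4) by blast
    qed
    then show "edim sP (closure ?G) = \<infinity>"
      by (metis Suc_n_not_le_n enat_ord_simps(1) not_infinity_eq)
    show "norm (snd p) \<le> \<delta> * norm (fst p)" if "p \<in> closure ?G" for p
      using cone that by auto
  qed
qed

text \<open>In the cone a vanishing first component forces a vanishing second one, so the first
  projection is injective on \<open>L\<close> and its inverse is linear.\<close>

lemma edim_le_edim_fst:
  assumes L: "P.subspace L" and cone: "\<And>p. p \<in> L \<Longrightarrow> norm (snd p) \<le> \<delta> * norm (fst p)"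
  shows "X.subspace (fst ` L)" "edim sP L \<le> edim sX (fst ` L)"
proof -
  have inj: "p = q" if pq: "p \<in> L" "q \<in> L" "fst p = fst q" for p q
  proof -
    have "p - q \<in> L" using pq by (intro P.subspace_diff[OF L])
    then have "norm (snd (p - q)) \<le> 0" using cone[of "p - q"] pq(3) by simp
    then show ?thesis using pq(3) by (simp add: prod_eq_iff)
  qed
  then have inj_on: "inj_on fst L" by (rule inj_onI)
  show sub: "X.subspace (fst ` L)"
  proof (rule X.subspaceI)
    show "0 \<in> fst ` L" by (rule image_eqI[of _ _ 0]) (auto simp: P.subspace_0[OF L])
    show "x + y \<in> fst ` L" if xy: "x \<in> fst ` L" "y \<in> fst ` L" for x y
    proof -
      obtain p q where pq: "p \<in> L" "q \<in> L" "x = fst p" "y = fst q" using xy by blast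
      then have "p + q \<in> L" by (intro P.subspace_add[OF L])
      then show ?thesis by (rule rev_image_eqI) (simp add: pq)
    qed
    show "sX c x \<in> fst ` L" if x: "x \<in> fst ` L" for c x
    proof -
      obtain p where p: "p \<in> L" "x = fst p" using x by blast
      then have "sP c p \<in> L" by (intro P.subspace_scale[OF L])
      then show ?thesis by (rule rev_image_eqI) (simp add: sP_def p)
    qed
  qed
  let ?g = "inv_into L fst"
  have g: "?g (fst p) = p" if "p \<in> L" for p using inj_on that by simp
  have "edim sP (?g ` fst ` L) \<le> edim sX (fst ` L)"
  proof (intro edim_image_le X.vector_space_axioms P.vector_space_axioms sub)
    fix x y assume "x \<in> fst ` L" "y \<in> fst ` L"
    then obtain p q where pq: "p \<in> L" "q \<in> L" "x = fst p" "y = fst q" by blast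
    have "p + q \<in> L" using pq by (intro P.subspace_add[OF L])
    then show "?g (x + y) = ?g x + ?g y" using g[of "p + q"] g pq by simp
  next
    fix c x assume "x \<in> fst ` L"
    then obtain p where p: "p \<in> L" "x = fst p" by blast
    have "sP c p \<in> L" using p by (intro P.subspace_scale[OF L])
    then show "?g (sX c x) = sP c (?g x)" using g[of "sP c p"] g[OF p(1)] p by (simp add: sP_def)
  qed
  moreover have "?g ` fst ` L = L" using g by (auto simp: image_image)
  ultimately show "edim sP L \<le> edim sX (fst ` L)" by simp
qed

end

section \<open>Adjustment numbers\<close>

lemma eventually_along: "eventually P (along N) \<longleftrightarrow> (\<exists>m. \<forall>n\<in>N. m \<le> n \<longrightarrow> P n)"
  by (auto simp: along_def eventually_inf_principal eventually_sequentially)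

lemma not_eventually_along: "\<not> eventually P (along N) \<longleftrightarrow> infinite {n \<in> N. \<not> P n}"
  by (auto simp: eventually_along infinite_nat_iff_unbounded_le)

lemma infinite_eventually_along:
  assumes "eventually P (along N)" "infinite N"
  shows "infinite {n \<in> N. P n}"
proof -
  have "finite {n \<in> N. \<not> P n}" using assms(1) not_eventually_along by blast
  moreover have "N = {n \<in> N. P n} \<union> {n \<in> N. \<not> P n}" by blast
  ultimately show ?thesis using assms(2) by (metis finite_UnI)
qed

text \<open>Zero vectors for \<open>y\<close> and \<open>z\<close> leave the unit vectors
  themselves. Hence the set under the infimum is nonempty, so an infimum below
  \<open>\<epsilon>\<close> has a witness below \<open>\<epsilon>\<close>.\<close>

lemma lower_uniformly_adjusted_1:
  assumes "\<And>n. n \<in> N \<Longrightarrow> 0 \<in> P n"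
  shows "lower_uniformly_adjusted \<nu> N M P 1"
  unfolding lower_uniformly_adjusted_def
proof (intro allI impI, elim conjE)
  fix \<eta> :: real and N' and x :: "nat \<Rightarrow> 'a"
  assume h: "\<eta> > 0" "N' \<subseteq> N" "infinite N'" "\<forall>n\<in>N'. x n \<in> M n \<and> \<nu> (x n) = 1"
  have "Limsup (along N') (\<lambda>n. ereal (\<nu> (x n - 0 - 0))) \<le> ereal (1 + \<eta>)"
    using h by (intro Limsup_bounded) (auto simp: eventually_along)
  then show "\<exists>N'' y z. N'' \<subseteq> N' \<and> infinite N'' \<and> (\<forall>n\<in>N''. y n \<in> P n) \<and>
      Limsup (along N'') (\<lambda>n. ereal (\<nu> (x n - y n - z))) \<le> ereal (1 + \<eta>)"
    using h assms by (intro exI[of _ N'] exI[of _ "\<lambda>_. 0"] exI[of _ 0]) auto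
qed

lemma uadj_le_1:
  assumes "\<And>n. n \<in> N \<Longrightarrow> 0 \<in> P n"
  shows "uadj \<nu> N M P \<le> 1"
  unfolding uadj_def using lower_uniformly_adjusted_1[OF assms]
  by (intro cInf_lower bdd_belowI[of _ 0]) auto

lemma uadj_lessD:
  assumes "\<And>n. n \<in> N \<Longrightarrow> 0 \<in> P n" "uadj \<nu> N M P < \<epsilon>"
  obtains \<kappa> where "\<kappa> < \<epsilon>" "lower_uniformly_adjusted \<nu> N M P \<kappa>"
proof -
  have "1 \<in> {\<kappa>. \<kappa> \<ge> 0 \<and> lower_uniformly_adjusted \<nu> N M P \<kappa>}"
    using lower_uniformly_adjusted_1[OF assms(1)] by simp
  then show thesis using cInf_lessD[OF _ assms(2)[unfolded uadj_def]] that by blast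
qed

lemma SS_uadj_lessD:
  assumes "\<And>n. n \<in> N \<Longrightarrow> 0 \<in> P n" "SS_uadj s \<nu> N M P < \<epsilon>"
  obtains \<kappa> where "\<kappa> < \<epsilon>" "SS_adjusted s \<nu> N M P \<kappa>"
proof -
  have "SS_adjusted s \<nu> N M P 1"
    unfolding SS_adjusted_def
  proof (intro allI impI)
    fix N' K
    assume h: "N' \<subseteq> N \<and> infinite N' \<and>
      (\<forall>n\<in>N'. closed_subspace s (K n) \<and> K n \<subseteq> M n \<and> edim s (K n) = \<infinity>)"
    then have "uadj \<nu> N' K P \<le> 1" using assms(1) by (intro uadj_le_1) blast
    then show "\<exists>N'' L. N'' \<subseteq> N' \<and> infinite N'' \<and>
        (\<forall>n\<in>N''. closed_subspace s (L n) \<and> L n \<subseteq> K n \<and> edim s (L n) = \<infinity>) \<and>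
        uadj \<nu> N'' L P \<le> 1"
      using h by (intro exI[of _ N'] exI[of _ K]) simp
  qed
  then have "1 \<in> {\<kappa>. \<kappa> \<ge> 0 \<and> SS_adjusted s \<nu> N M P \<kappa>}" by simp
  then show thesis using cInf_lessD[OF _ assms(2)[unfolded SS_uadj_def]] that by blast
qed

lemma FSS_uadj_lessD:
  assumes s: "vector_space s" and P: "\<And>n. n \<in> N \<Longrightarrow> 0 \<in> P n" and less: "FSS_uadj s \<nu> N M P < \<epsilon>"
  obtains \<kappa> where "\<kappa> < \<epsilon>" "FSS_adjusted s \<nu> N M P \<kappa>"
proof -
  interpret vector_space s by fact
  have "FSS_adjusted s \<nu> N M P 1"
    unfolding FSS_adjusted_def
  proof (intro allI impI, elim conjE)
    fix N' K
    assume h: "N' \<subseteq> N" "infinite N'" "\<forall>n\<in>N'. subspace (K n) \<and> K n \<subseteq> M n \<and> edim s (K n) < \<infinity>"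
      and lim: "((\<lambda>n. edim s (K n)) \<longlongrightarrow> \<infinity>) (along N')"
    \<comment> \<open>The chosen subspaces must be nonzero, so indices with trivial
      \<open>K n\<close> are dropped; the growing dimensions leave infinitely many.\<close>
    define N'' where "N'' = {n \<in> N'. 0 < edim s (K n)}"
    have sub: "N'' \<subseteq> N'" by (auto simp: N''_def)
    have "eventually (\<lambda>n. 0 < edim s (K n)) (along N')"
      using order_tendstoD(1)[OF lim, of 0] by simp
    then have "infinite N''" unfolding N''_def using h(2) by (rule infinite_eventually_along)
    moreover have "K n \<noteq> {0}" if "n \<in> N''" for n
      using that edim_le_card[of "{}" "K n"] by (auto simp: N''_def zero_enat_def[symmetric])
    moreover have "((\<lambda>n. edim s (K n)) \<longlongrightarrow> \<infinity>) (along N'')"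
      using lim by (rule tendsto_mono[rotated]) (use sub in \<open>auto simp: along_def le_infI2\<close>)
    moreover have "uadj \<nu> N'' K P \<le> 1" using P sub h(1) by (intro uadj_le_1) blast
    ultimately show "\<exists>N'' L. N'' \<subseteq> N' \<and> infinite N'' \<and>
        (\<forall>n\<in>N''. subspace (L n) \<and> L n \<subseteq> K n \<and> L n \<noteq> {0}) \<and>
        ((\<lambda>n. edim s (L n)) \<longlongrightarrow> \<infinity>) (along N'') \<and> uadj \<nu> N'' L P \<le> 1"
      using h sub by (intro exI[of _ N''] exI[of _ K]) auto
  qed
  then have "1 \<in> {\<kappa>. \<kappa> \<ge> 0 \<and> FSS_adjusted s \<nu> N M P \<kappa>}" by simp
  then show thesis using cInf_lessD[OF _ less[unfolded FSS_uadj_def]] that by blast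
qed

lemma max_norm_less_iff: "max_norm p < r \<longleftrightarrow> norm (fst p) < r \<and> norm (snd p) < r"
  by (simp add: max_norm_def)

text \<open>Infinitely many indices share one of finitely many balls of radius
  \<open>e/2\<close>.\<close>

lemma close_pair_in_compact:
  fixes k :: "nat \<Rightarrow> 'a::metric_space"
  assumes "infinite I" "compact C" "\<And>i. i \<in> I \<Longrightarrow> k i \<in> C" "e > 0"
  obtains i j where "i \<in> I" "j \<in> I" "i < j" "dist (k i) (k j) < e"
proof -
  have "e/2 > 0" using assms(4) by simp
  then obtain K where K: "finite K" "C \<subseteq> (\<Union>x\<in>K. ball x (e/2))"
    using assms(2) unfolding compact_eq_totally_bounded by blast
  have "\<forall>i\<in>I. \<exists>x\<in>K. k i \<in> ball x (e/2)" using K(2) assms(3) by blast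
  from pigeonhole_infinite_rel[OF assms(1) K(1) this]
  obtain x where x: "infinite {i \<in> I. k i \<in> ball x (e/2)}" by blast
  then obtain i where i: "i \<in> I" "k i \<in> ball x (e/2)" using infinite_imp_nonempty by blast
  obtain j where j: "i < j" "j \<in> I" "k j \<in> ball x (e/2)"
    using x unfolding infinite_nat_iff_unbounded by blast
  have "dist (k i) (k j) < e"
    by (rule dist_triangle_half_r[of x]) (use i(2) j(3) in auto)
  then show thesis using that i j by blast
qed

section \<open>A lower bound for adjustment to a lower semi-Fredholm graph\<close>

context closed_op
begin

text \<open>Serves both halves of the theorem: the dimension condition covers finite dimensions
  tending to infinity as well as infinite ones. The bound comes from \<open>A\<close> alone, through
  its preimage constant \<open>c\<close>.\<close>

lemma uadj_graph_ge:
  assumes lsF: "lower_semi_Fredholm sX sY A"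
  shows "\<exists>\<epsilon>>0. \<forall>N L. infinite N \<longrightarrow>
    (\<forall>n\<in>N. P.subspace (L n) \<and> (\<forall>p\<in>L n. norm (snd p) \<le> \<epsilon> * norm (fst p))) \<longrightarrow>
    (\<forall>k. eventually (\<lambda>n. enat k \<le> edim sP (L n)) (along N)) \<longrightarrow>
    \<epsilon> \<le> uadj max_norm N L (\<lambda>_. op_graph A)"
proof -
  have "closed (op_range A)" and ker: "edim sX (op_ker A) < \<infinity>"
    using lsF by (auto simp: lower_semi_Fredholm_def)
  from closed_range_imp_bounded_preimages[OF this(1)] obtain c
    where c: "c \<ge> 0" "\<And>y. y \<in> op_range A \<Longrightarrow> \<exists>x\<in>D. T x = y \<and> norm x \<le> c * norm y"
    by blast
  \<comment> \<open>Chosen for the final estimate of \<open>x j - x i\<close>: twice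
    \<open>2 * \<epsilon>\<close> from the adjustment, \<open>\<epsilon>\<close> from the kernel
    parts and twice \<open>6 * c * \<epsilon>\<close> from the preimages must not exceed the
    separation \<open>1/4\<close>.\<close>
  define \<epsilon> where "\<epsilon> = 1 / (4 * (5 + 12 * c))"
  have \<epsilon>: "\<epsilon> > 0" using c by (simp add: \<epsilon>_def)
  have \<epsilon>1: "\<epsilon> < 1" using c by (simp add: \<epsilon>_def)
  have \<epsilon>4: "5 * \<epsilon> + 12 * c * \<epsilon> = 1/4"
  proof -
    have "5 * \<epsilon> + 12 * c * \<epsilon> = (5 + 12 * c) * \<epsilon>" by (simp add: algebra_simps)
    also have "\<dots> = 1/4" using c(1) by (simp add: \<epsilon>_def)
    finally show ?thesis .
  qed
  show ?thesis
  proof (intro exI[of _ \<epsilon>] conjI \<epsilon> allI impI, rule ccontr)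
    fix N L
    assume N: "infinite N"
      and L: "\<forall>n\<in>N. P.subspace (L n) \<and> (\<forall>p\<in>L n. norm (snd p) \<le> \<epsilon> * norm (fst p))"
      and dim': "\<forall>k. eventually (\<lambda>n. enat k \<le> edim sP (L n)) (along N)"
      and less: "\<not> \<epsilon> \<le> uadj max_norm N L (\<lambda>_. op_graph A)"
    have dim: "eventually (\<lambda>n. enat k \<le> edim sP (L n)) (along N)" for k using dim' by blast
    have sub: "P.subspace (L n)" if "n \<in> N" for n using L that by blast
    have cone: "norm (snd p) \<le> \<epsilon> * norm (fst p)" if "n \<in> N" "p \<in> L n" for n p
      using L that by blast
    have "uadj max_norm N L (\<lambda>_. op_graph A) < \<epsilon>" using less by simp
    then obtain \<kappa> where \<kappa>: "\<kappa> < \<epsilon>" "lower_uniformly_adjusted max_norm N L (\<lambda>_. op_graph A) \<kappa>"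
      using uadj_lessD[of N "\<lambda>_. op_graph A" max_norm L \<epsilon>] P.subspace_0[OF subspace_graph] by blast
    \<comment> \<open>Adjustment tests one vector per index, so the separated points are drawn with
      strictly increasing indices from different spaces \<open>L n\<close>.\<close>
    define Q where "Q = (\<lambda>n x. n \<in> N \<and> norm x = 1 \<and> (\<exists>t. (x, t) \<in> L n))"
    have "\<exists>n>M. \<exists>x. Q n x \<and> (\<forall>y\<in>K. 1/4 \<le> dist x y)" if K: "finite K" for K M
    proof -
      have "infinite {n \<in> N. enat (Suc (card K)) \<le> edim sP (L n)}"
        by (rule infinite_eventually_along[OF dim N])
      then obtain n where n: "M < n" "n \<in> N" "enat (Suc (card K)) \<le> edim sP (L n)"
        unfolding infinite_nat_iff_unbounded by blast
      note fst_L = edim_le_edim_fst[OF sub[OF n(2)] cone[OF n(2)]]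
      have "enat (Suc (card K)) \<le> edim sX (fst ` L n)"
        using n(3) fst_L(2) by (rule order_trans)
      from X.unit_vector_away_from_finite[OF fst_L(1) K this]
      obtain x where x: "x \<in> fst ` L n" "norm x = 1" "\<And>y. y \<in> K \<Longrightarrow> 1/4 \<le> dist x y" by blast
      have "Q n x" using x n by (auto simp: Q_def)
      then show ?thesis using n(1) x(3) by blast
    qed
    from separated_sequence[of Q "1/4", OF this]
    obtain r :: "nat \<Rightarrow> nat" and x where r: "strict_mono r" and Q: "\<And>i. Q (r i) (x i)"
      and sep: "\<And>i j. i < j \<Longrightarrow> 1/4 \<le> dist (x j) (x i)"
      by blast
    obtain t where t: "\<And>i. (x i, t i) \<in> L (r i)" using Q unfolding Q_def by metis
    have x1: "norm (x i) = 1" and rN: "r i \<in> N" for i using Q by (auto simp: Q_def)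
    have t1: "norm (t i) \<le> \<epsilon>" for i using cone[OF rN t, of i] x1 by simp
    have inj: "inj r" using r by (rule strict_mono_imp_inj_on)
    \<comment> \<open>Position \<open>i\<close> is translated back to the index \<open>r i\<close>.
      These are unit vectors for \<open>max_norm\<close>, because the second components have norm at
      most \<open>\<epsilon> < 1\<close>.\<close>
    define p where "p = (\<lambda>n. (x (inv r n), t (inv r n)))"
    have p: "p (r i) = (x i, t i)" for i using inj by (simp add: p_def)
    have unit: "range r \<subseteq> N \<and> infinite (range r) \<and> (\<forall>n\<in>range r. p n \<in> L n \<and> max_norm (p n) = 1)"
    proof (intro conjI)
      show "range r \<subseteq> N" using rN by blast
      show "infinite (range r)" using inj by (simp add: finite_image_iff)
      have "max_norm (x i, t i) = 1" for i using x1[of i] t1[of i] \<epsilon>1 by (simp add: max_norm_def)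
      then show "\<forall>n\<in>range r. p n \<in> L n \<and> max_norm (p n) = 1" using p t by simp
    qed
    from \<kappa>(2)[unfolded lower_uniformly_adjusted_def, THEN spec, THEN mp, OF \<epsilon>,
        THEN spec, THEN spec, THEN mp, OF unit]
    obtain N2 y z where N2: "N2 \<subseteq> range r" "infinite N2" "\<And>n. n \<in> N2 \<Longrightarrow> y n \<in> op_graph A"
      and limsup: "Limsup (along N2) (\<lambda>n. ereal (max_norm (p n - y n - z))) \<le> ereal (\<kappa> + \<epsilon>)"
      by blast
    have "ereal (\<kappa> + \<epsilon>) < ereal (2 * \<epsilon>)" using \<kappa>(1) by simp
    with limsup have "Limsup (along N2) (\<lambda>n. ereal (max_norm (p n - y n - z))) < ereal (2 * \<epsilon>)"
      by (rule le_less_trans)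
    from Limsup_lessD[OF this]
    have "infinite {n \<in> N2. ereal (max_norm (p n - y n - z)) < ereal (2 * \<epsilon>)}"
      using N2(2) by (rule infinite_eventually_along)
    moreover define I where "I = {i. r i \<in> N2 \<and> max_norm (p (r i) - y (r i) - z) < 2 * \<epsilon>}"
    have "{n \<in> N2. ereal (max_norm (p n - y n - z)) < ereal (2 * \<epsilon>)} \<subseteq> r ` I"
      using N2(1) by (auto simp: I_def)
    ultimately have I: "infinite I" by (meson finite_imageI finite_subset)
    define v where "v = (\<lambda>i. fst (y (r i)))"
    define a b where "a = fst z" and "b = snd z"
    have v: "v i \<in> D" "norm (x i - v i - a) < 2 * \<epsilon>" "norm (t i - T (v i) - b) < 2 * \<epsilon>" if i: "i \<in> I" for i
    proof -
      have "r i \<in> N2" and less: "max_norm (p (r i) - y (r i) - z) < 2 * \<epsilon>" using i by (auto simp: I_def)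
      from N2(3)[OF this(1)] have y: "v i \<in> D" "y (r i) = (v i, T (v i))"
        by (auto simp: op_graph_def v_def)
      then show "v i \<in> D" "norm (x i - v i - a) < 2 * \<epsilon>" "norm (t i - T (v i) - b) < 2 * \<epsilon>"
        using less by (simp_all add: max_norm_less_iff p a_def b_def)
    qed
    \<comment> \<open>Differences with a fixed reference cancel the unknown \<open>b\<close>; their
      images have norm at most \<open>6 * \<epsilon>\<close>, two \<open>2 * \<epsilon>\<close> from
      the adjustment and two \<open>\<epsilon>\<close> from the cone.\<close>
    obtain i0 where i0: "i0 \<in> I" using I infinite_imp_nonempty by blast
    have "\<exists>w\<in>D. T w = T (v i - v i0) \<and> norm w \<le> c * (6 * \<epsilon>)" if i: "i \<in> I" for i
    proof -
      have "v i - v i0 \<in> D" by (intro dom_diff v i i0)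
      then have "T (v i - v i0) \<in> op_range A" by (simp add: op_range_def)
      from c(2)[OF this] obtain w where w: "w \<in> D" "T w = T (v i - v i0)" "norm w \<le> c * norm (T (v i - v i0))"
        by blast
      have "T (v i - v i0) = (t i0 - T (v i0) - b) - (t i - T (v i) - b) + (t i - t i0)"
        using v i i0 by (simp add: app_diff)
      then have "norm (T (v i - v i0)) \<le> norm ((t i0 - T (v i0) - b) - (t i - T (v i) - b)) + norm (t i - t i0)"
        by (metis norm_triangle_ineq)
      also have "\<dots> \<le> (norm (t i0 - T (v i0) - b) + norm (t i - T (v i) - b)) + (norm (t i) + norm (t i0))"
        by (intro add_mono norm_triangle_ineq4)
      also have "\<dots> \<le> 6 * \<epsilon>" using v(3)[OF i] v(3)[OF i0] t1[of i] t1[of i0] by linarith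
      finally have "c * norm (T (v i - v i0)) \<le> c * (6 * \<epsilon>)" using c(1) by (rule mult_left_mono)
      then show ?thesis using w by (metis order_trans)
    qed
    then obtain w where w: "\<And>i. i \<in> I \<Longrightarrow> w i \<in> D" "\<And>i. i \<in> I \<Longrightarrow> T (w i) = T (v i - v i0)"
      "\<And>i. i \<in> I \<Longrightarrow> norm (w i) \<le> c * (6 * \<epsilon>)"
      by metis
    \<comment> \<open>Removing the small preimage \<open>w i\<close> leaves a kernel vector, bounded
      uniformly in \<open>i\<close>, so compactness brings two of them together.\<close>
    define k where "k = (\<lambda>i. v i - v i0 - w i)"
    define B where "B = 2 * (1 + 2 * \<epsilon> + norm a) + c * (6 * \<epsilon>)"
    have "k i \<in> op_ker A \<inter> cball 0 B" if i: "i \<in> I" for i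
    proof -
      have D: "v i - v i0 \<in> D" by (intro dom_diff v i i0)
      have "k i \<in> op_ker A" using D w i by (simp add: k_def op_ker_def dom_diff app_diff)
      moreover have vn: "norm (v j) \<le> 1 + 2 * \<epsilon> + norm a" if j: "j \<in> I" for j
      proof -
        have "v j = x j - (x j - v j - a) - a" by simp
        then have "norm (v j) \<le> norm (x j - (x j - v j - a)) + norm a" by (metis norm_triangle_ineq4)
        also have "\<dots> \<le> norm (x j) + norm (x j - v j - a) + norm a"
          using norm_triangle_ineq4[of "x j" "x j - v j - a"] by linarith
        finally show ?thesis using v(2)[OF j] x1[of j] by linarith
      qed
      moreover have "norm (k i) \<le> norm (v i) + norm (v i0) + norm (w i)"
        unfolding k_def using norm_triangle_ineq4[of "v i - v i0" "w i"] norm_triangle_ineq4[of "v i" "v i0"]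
        by linarith
      ultimately show ?thesis using vn[OF i] vn[OF i0] w(3)[OF i] by (simp add: B_def)
    qed
    moreover have "compact (op_ker A \<inter> cball 0 B)"
      using X.finite_dim_basis[OF subspace_ker ker] X.compact_span_cball by metis
    ultimately obtain i j where ij: "i \<in> I" "j \<in> I" "i < j" "dist (k i) (k j) < \<epsilon>"
      using close_pair_in_compact[OF I _ _ \<epsilon>, of "op_ker A \<inter> cball 0 B" k] by blast
    \<comment> \<open>Both \<open>a\<close> and \<open>v i0\<close> cancel, and only quantities
      already shown to be small remain.\<close>
    have "x j - x i = ((x j - v j - a) - (x i - v i - a)) + ((w j - w i) - (k i - k j))"
      by (simp add: k_def)
    then have "norm (x j - x i) \<le> norm ((x j - v j - a) - (x i - v i - a)) + norm ((w j - w i) - (k i - k j))"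
      by (metis norm_triangle_ineq)
    also have "\<dots> \<le> (norm (x j - v j - a) + norm (x i - v i - a)) + ((norm (w j) + norm (w i)) + norm (k i - k j))"
      by (intro add_mono norm_triangle_ineq4 order_trans[OF norm_triangle_ineq4] order_refl)
    also have "\<dots> < 5 * \<epsilon> + 12 * c * \<epsilon>"
      using v(2)[OF ij(1)] v(2)[OF ij(2)] w(3)[OF ij(1)] w(3)[OF ij(2)] ij(4)
      by (simp add: dist_norm)
    finally show False using sep[OF ij(3)] \<epsilon>4 by (simp add: dist_norm)
  qed
qed

end

section \<open>Stability of lower semi-Fredholm operators\<close>

text \<open>The same \<open>\<epsilon>\<close> works for both parts. Failure would provide test
  spaces in the cone, and every choice of subspaces of them that the adjustment returns meets the
  lower bound \<open>\<epsilon>\<close>.\<close>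

theorem theorem4p2p3:
  fixes sX :: "'k::{real_normed_field,euclidean_space} \<Rightarrow> 'a::banach \<Rightarrow> 'a"
    and sY :: "'k \<Rightarrow> 'b::banach \<Rightarrow> 'b"
    and A :: "('a, 'b) partial_op"
  assumes "banach_space_over sX" and "banach_space_over sY"
    and "lower_semi_Fredholm sX sY A"
  shows "(\<exists>\<epsilon>>0. \<forall>(N :: nat set) (An :: nat \<Rightarrow> ('a, 'b) partial_op).
            infinite N \<and>
            (\<forall>n\<in>N. closed_operator sX sY (An n) \<and> op_dom (An n) \<noteq> {0}) \<and>
            FSS_uadj_op sX sY N An (\<lambda>_. A) < \<epsilon> \<longrightarrow>
            (\<forall>\<^sub>F n in along N. lower_semi_Fredholm sX sY (An n)) \<and>
            Limsup (along N) (\<lambda>n. edim sX (op_ker (An n))) < \<infinity>)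
       \<and> (\<exists>\<epsilon>>0. \<forall>(N :: nat set) (An :: nat \<Rightarrow> ('a, 'b) partial_op).
            infinite N \<and>
            (\<forall>n\<in>N. closed_operator sX sY (An n) \<and> op_dom (An n) \<noteq> {0}) \<and>
            SS_uadj_op sX sY N An (\<lambda>_. A) < \<epsilon> \<longrightarrow>
            (\<forall>\<^sub>F n in along N. lower_semi_Fredholm sX sY (An n)))"
proof -
  interpret X: banach_over sX by (rule banach_over.intro) (rule assms(1))
  interpret Y: banach_over sY by (rule banach_over.intro) (rule assms(2))
  have closed_op: "closed_op sX sY C" if "closed_operator sX sY C" for C :: "('a, 'b) partial_op"
    by unfold_locales (rule that)
  interpret A: closed_op sX sY A
    using assms(3) by (intro closed_op) (simp add: lower_semi_Fredholm_def)
  let ?s = "module_prod.scale sX sY"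
  obtain \<epsilon> where \<epsilon>: "\<epsilon> > 0" and
    ge: "\<And>N L. infinite N \<Longrightarrow>
      \<forall>n\<in>N. A.P.subspace (L n) \<and> (\<forall>p\<in>L n. norm (snd p) \<le> \<epsilon> * norm (fst p)) \<Longrightarrow>
      \<forall>k. eventually (\<lambda>n. enat k \<le> edim ?s (L n)) (along N) \<Longrightarrow>
      \<epsilon> \<le> uadj max_norm N L (\<lambda>_. op_graph A)"
    using A.uadj_graph_ge[OF assms(3)] by blast
  have graph_0: "0 \<in> op_graph A" by (rule A.P.subspace_0[OF A.subspace_graph])
  show ?thesis
  proof (intro conjI exI[of _ \<epsilon>] \<epsilon> allI impI; elim conjE)
    fix N :: "nat set" and An :: "nat \<Rightarrow> ('a, 'b) partial_op"
    assume N: "infinite N" and An: "\<forall>n\<in>N. closed_operator sX sY (An n) \<and> op_dom (An n) \<noteq> {0}"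
      and FSS: "FSS_uadj_op sX sY N An (\<lambda>_. A) < \<epsilon>"
    have cl: "closed_op sX sY (An n)" if "n \<in> N" for n using An that closed_op by blast
    define H where "H = (\<lambda>n m K. A.P.subspace K \<and> K \<subseteq> op_graph (An n) \<and> edim ?s K = enat m \<and>
      (\<forall>p\<in>K. norm (snd p) \<le> \<epsilon> * norm (fst p)))"
    \<comment> \<open>One dimension \<open>m\<close> that the cone eventually excludes yields both
      conclusions, since kernels and infinite-dimensional approximate kernels give graph subspaces
      inside the cone.\<close>
    have "\<exists>m. eventually (\<lambda>n. \<nexists>K. H n m K) (along N)"
    proof (rule ccontr)
      assume "\<not> ?thesis"
      then have inf: "infinite {n \<in> N. \<exists>K. H n m K}" for m
        using not_eventually_along[of "\<lambda>n. \<nexists>K. H n m K" N] by auto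
      \<comment> \<open>The space chosen at index \<open>r m\<close> has dimension exactly
        \<open>m\<close>, so the dimensions tend to infinity along the range of
        \<open>r\<close>.\<close>
      have "\<exists>r. \<forall>m::nat. (r m \<in> N \<and> (\<exists>K. H (r m) m K)) \<and> r m < r (Suc m)"
      proof (rule dependent_nat_choice)
        show "\<exists>n. n \<in> N \<and> (\<exists>K. H n 0 K)" using infinite_imp_nonempty[OF inf[of 0]] by blast
        show "\<exists>n'. (n' \<in> N \<and> (\<exists>K. H n' (Suc m) K)) \<and> n < n'" for n m
          using inf[of "Suc m"] unfolding infinite_nat_iff_unbounded by blast
      qed
      then obtain r where r: "\<And>m. r m \<in> N" "\<And>m. \<exists>K. H (r m) m K" "strict_mono r"
        by (metis strict_mono_Suc_iff)
      obtain K' where K': "\<And>m. H (r m) m (K' m)" using r(2) by metis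
      have inj: "inj r" using r(3) by (rule strict_mono_imp_inj_on)
      define K where "K = (\<lambda>n. K' (inv r n))"
      have K: "H (r m) m (K (r m))" for m using K' inj by (simp add: K_def)
      obtain \<kappa> where \<kappa>: "\<kappa> < \<epsilon>"
        "FSS_adjusted ?s max_norm N (\<lambda>n. op_graph (An n)) (\<lambda>_. op_graph A) \<kappa>"
        using FSS_uadj_lessD[OF A.P.vector_space_axioms graph_0 FSS[unfolded FSS_uadj_op_def]] by blast
      have "((\<lambda>n. edim ?s (K n)) \<longlongrightarrow> \<infinity>) (along (range r))"
      proof (rule order_tendstoI)
        fix a :: enat assume "a < \<infinity>"
        then obtain k where k: "a = enat k" by auto
        have "a < edim ?s (K n)" if n: "n \<in> range r" "r (Suc k) \<le> n" for n
        proof -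
          obtain m where m: "n = r m" using n(1) by blast
          then have "Suc k \<le> m" using n(2) strict_mono_less_eq[OF r(3)] by simp
          then show ?thesis using K[of m] by (simp add: H_def m k)
        qed
        then show "eventually (\<lambda>n. a < edim ?s (K n)) (along (range r))"
          unfolding eventually_along by blast
      qed simp
      moreover have "\<forall>n\<in>range r. A.P.subspace (K n) \<and> K n \<subseteq> op_graph (An n) \<and> edim ?s (K n) < \<infinity>"
        using K by (auto simp: H_def)
      moreover have "range r \<subseteq> N" "infinite (range r)"
        using r(1) inj by (auto simp: finite_image_iff)
      ultimately have "range r \<subseteq> N \<and> infinite (range r) \<and>
          (\<forall>n\<in>range r. A.P.subspace (K n) \<and> K n \<subseteq> op_graph (An n) \<and> edim ?s (K n) < \<infinity>) \<and>
          ((\<lambda>n. edim ?s (K n)) \<longlongrightarrow> \<infinity>) (along (range r))"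
        by (intro conjI)
      from \<kappa>(2)[unfolded FSS_adjusted_def, THEN spec, THEN spec, THEN mp, OF this]
      obtain N'' L where L: "N'' \<subseteq> range r" "infinite N''"
        "\<And>n. n \<in> N'' \<Longrightarrow> A.P.subspace (L n) \<and> L n \<subseteq> K n"
        "((\<lambda>n. edim ?s (L n)) \<longlongrightarrow> \<infinity>) (along N'')" "uadj max_norm N'' L (\<lambda>_. op_graph A) \<le> \<kappa>"
        by blast
      \<comment> \<open>The cone condition passes to the subspaces \<open>L n\<close> of
        \<open>K n\<close>, whichever they are.\<close>
      have "\<epsilon> \<le> uadj max_norm N'' L (\<lambda>_. op_graph A)"
      proof (rule ge[OF L(2)]; intro ballI conjI allI)
        show "A.P.subspace (L n)" if "n \<in> N''" for n using L(3) that by blast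
        show "norm (snd p) \<le> \<epsilon> * norm (fst p)" if p: "n \<in> N''" "p \<in> L n" for n p
        proof -
          obtain m where "n = r m" using p(1) L(1) by blast
          then have "p \<in> K (r m)" using L(3)[OF p(1)] p(2) by blast
          then show ?thesis using K[of m] by (simp add: H_def)
        qed
        show "eventually (\<lambda>n. enat k \<le> edim ?s (L n)) (along N'')" for k
          using order_tendstoD(1)[OF L(4), of "enat k"] by (auto elim: eventually_mono)
      qed
      then show False using L(5) \<kappa>(1) by simp
    qed
    then obtain m where "eventually (\<lambda>n. \<nexists>K. H n m K) (along N)" by blast
    moreover have "eventually (\<lambda>n. n \<in> N) (along N)" by (auto simp: eventually_along)
    ultimately have noH: "eventually (\<lambda>n. n \<in> N \<and> (\<nexists>K. H n m K)) (along N)"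
      by eventually_elim blast
    have small: "edim sX V < enat m"
      if "n \<in> N" "\<nexists>K. H n m K" "X.subspace V" "V \<subseteq> op_dom (An n)"
        "\<And>v. v \<in> V \<Longrightarrow> norm (op_app (An n) v) \<le> \<epsilon> * norm v" for n V
    proof (rule ccontr)
      assume "\<not> edim sX V < enat m"
      then have "enat m \<le> edim sX V" by simp
      then show False
        using closed_op.finite_dimensional_graph_subspace[OF cl[OF \<open>n \<in> N\<close>] that(3,4) _ that(5)] that(2)
        unfolding H_def by metis
    qed
    show "\<forall>\<^sub>F n in along N. lower_semi_Fredholm sX sY (An n)"
      using noH
    proof eventually_elim
      case (elim n)
      show ?case
      proof (rule ccontr)
        assume "\<not> ?thesis"
        then obtain V where V: "X.subspace V" "V \<subseteq> op_dom (An n)" "edim sX V = \<infinity>"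
          "\<And>v. v \<in> V \<Longrightarrow> norm (op_app (An n) v) \<le> \<epsilon> * norm v"
          using closed_op.infinite_dimensional_approximate_kernel[OF cl _ \<epsilon>, of n] elim by metis
        then show False using small[of n V] elim by simp
      qed
    qed
    have "eventually (\<lambda>n. edim sX (op_ker (An n)) \<le> enat m) (along N)"
      using noH
    proof eventually_elim
      case (elim n)
      have "edim sX (op_ker (An n)) < enat m"
        using elim \<epsilon> closed_op.subspace_ker[OF cl, of n]
        by (intro small[of n]) (auto simp: op_ker_def)
      then show ?case by simp
    qed
    then have "Limsup (along N) (\<lambda>n. edim sX (op_ker (An n))) \<le> enat m" by (rule Limsup_bounded)
    also have "\<dots> < \<infinity>" by simp
    finally show "Limsup (along N) (\<lambda>n. edim sX (op_ker (An n))) < \<infinity>" .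
  next
    fix N :: "nat set" and An :: "nat \<Rightarrow> ('a, 'b) partial_op"
    assume N: "infinite N" and An: "\<forall>n\<in>N. closed_operator sX sY (An n) \<and> op_dom (An n) \<noteq> {0}"
      and SS: "SS_uadj_op sX sY N An (\<lambda>_. A) < \<epsilon>"
    have cl: "closed_op sX sY (An n)" if "n \<in> N" for n using An that closed_op by blast
    show "\<forall>\<^sub>F n in along N. lower_semi_Fredholm sX sY (An n)"
    proof (rule ccontr)
      \<comment> \<open>If the conclusion fails, these exceptional indices form an infinite set,
        which serves as the index set of the test.\<close>
      define N' where "N' = {n \<in> N. \<not> lower_semi_Fredholm sX sY (An n)}"
      assume "\<not> ?thesis"
      then have N': "infinite N'" "N' \<subseteq> N" unfolding N'_def not_eventually_along by auto
      have "\<forall>n\<in>N'. \<exists>K. closed_subspace ?s K \<and> K \<subseteq> op_graph (An n) \<and> edim ?s K = \<infinity> \<and>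
          (\<forall>p\<in>K. norm (snd p) \<le> \<epsilon> * norm (fst p))"
      proof
        fix n assume "n \<in> N'"
        then have n: "n \<in> N" "\<not> lower_semi_Fredholm sX sY (An n)" by (auto simp: N'_def)
        show "\<exists>K. closed_subspace ?s K \<and> K \<subseteq> op_graph (An n) \<and> edim ?s K = \<infinity> \<and>
            (\<forall>p\<in>K. norm (snd p) \<le> \<epsilon> * norm (fst p))"
          by (rule closed_op.infinite_dimensional_graph_subspace[OF cl[OF n(1)] n(2) \<epsilon>]) blast
      qed
      from bchoice[OF this] obtain K where
        K: "\<And>n. n \<in> N' \<Longrightarrow> closed_subspace ?s (K n) \<and> K n \<subseteq> op_graph (An n) \<and> edim ?s (K n) = \<infinity>"
          "\<And>n p. n \<in> N' \<Longrightarrow> p \<in> K n \<Longrightarrow> norm (snd p) \<le> \<epsilon> * norm (fst p)"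
        by blast
      obtain \<kappa> where \<kappa>: "\<kappa> < \<epsilon>"
        "SS_adjusted ?s max_norm N (\<lambda>n. op_graph (An n)) (\<lambda>_. op_graph A) \<kappa>"
        using SS_uadj_lessD[OF graph_0 SS[unfolded SS_uadj_op_def]] by blast
      have "N' \<subseteq> N \<and> infinite N' \<and>
          (\<forall>n\<in>N'. closed_subspace ?s (K n) \<and> K n \<subseteq> op_graph (An n) \<and> edim ?s (K n) = \<infinity>)"
        using N' K(1) by blast
      from \<kappa>(2)[unfolded SS_adjusted_def, THEN spec, THEN spec, THEN mp, OF this]
      obtain N'' L where L: "N'' \<subseteq> N'" "infinite N''"
        "\<And>n. n \<in> N'' \<Longrightarrow> closed_subspace ?s (L n) \<and> L n \<subseteq> K n \<and> edim ?s (L n) = \<infinity>"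
        "uadj max_norm N'' L (\<lambda>_. op_graph A) \<le> \<kappa>"
        by blast
      have "\<epsilon> \<le> uadj max_norm N'' L (\<lambda>_. op_graph A)"
      proof (rule ge[OF L(2)]; intro ballI conjI allI)
        show "A.P.subspace (L n)" if "n \<in> N''" for n using L(3)[OF that] by (simp add: closed_subspace_def)
        show "norm (snd p) \<le> \<epsilon> * norm (fst p)" if "n \<in> N''" "p \<in> L n" for n p
          using K(2)[of n p] L(1) L(3)[OF that(1)] that by blast
        \<comment> \<open>Every \<open>L n\<close> is infinite-dimensional, so each bound holds from
          the first index on.\<close>
        show "eventually (\<lambda>n. enat k \<le> edim ?s (L n)) (along N'')" for k
          using L(3) by (simp add: eventually_along)
      qed
      then show False using L(4) \<kappa>(1) by simp
    qed
  qed
qed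

end
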